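(* Let $(E_6)^{\sigma}=\{\alpha\in E_6\mid \sigma\alpha\sigma=\alpha\}$ and $(E_6)^{\sigma'}=\{\alpha\in E_6\mid \sigma'\alpha\sigma'=\alpha\}$. Then $$(E_6)^{\sigma}\cap (E_6)^{\sigma'}\;\cong\;(U(1)\times U(1)\times Spin(8))/(\mathbf{Z}_2\times\mathbf{Z}_4),$$ where $\mathbf{Z}_2=\{(1,1,1),(1,-1,\sigma)\}$ and $\mathbf{Z}_4=\{(1,1,1),(-i,i,\sigma'),(-1,-1,1),(i,-i,\sigma')\}$.
   Context: Let $\mathfrak{C}$ be the division Cayley algebra (octonions), $\mathfrak{J}=\{X\in M(3,\mathfrak{C})\mid X^*=X\}$, with elements $X=\begin{pmatrix}\xi_1&x_3&\overline{x}_2\\ \overline{x}_3&\xi_2&x_1\\ x_2&\overline{x}_1&\xi_3\end{pmatrix}$, and let $\mathfrak{J}^C=\mathfrak{J}\oplus i\mathfrak{J}$ be its complexification ($C=\mathbf{R}\oplus\mathbf{R}i$), with $X\circ Y=\frac12(XY+YX)$, $(X,Y)=\mathrm{tr}(X\circ Y)$, $X\times Y=\frac12\big(2X\circ Y-\mathrm{tr}(X)Y-\mathrm{tr}(Y)X+(\mathrm{tr}(X)\mathrm{tr}(Y)-(X,Y))E\big)$, $\det X=\frac13(X,X\times X)$, complex conjugation $\tau(X+iY)=X-iY$ ($X,Y\in\mathfrak{J}$), and $\langle X,Y\rangle=(\tau X,Y)$. Then $E_6=\{\alpha\in\mathrm{Iso}_C(\mathfrak{J}^C)\mid \det\alpha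 X=\det X,\ \langle\alpha X,\alpha Y\rangle=\langle X,Y\rangle\}$. The involutive elements $\sigma,\sigma'\in E_6$ are the $C$-linear maps keeping all $\xi_k$, with $\sigma:(x_1,x_2,x_3)\mapsto(x_1,-x_2,-x_3)$ and $\sigma':(x_1,x_2,x_3)\mapsto(-x_1,-x_2,x_3)$. $Spin(8)=\{(\alpha_1,\alpha_2,\alpha_3)\in SO(8)^3\mid (\alpha_1x)(\alpha_2y)=\overline{\alpha_3(\overline{xy})},\ x,y\in\mathfrak{C}\}$, a triple being identified with the $C$-linear map of $\mathfrak{J}^C$ that keeps $\xi_k$ and sends $x_k\mapsto\alpha_kx_k$; under this identification $\sigma=(1,-1,-1)$ and $\sigma'=(-1,-1,1)$ are central elements of $Spin(8)$. $U(1)=\{\theta\in C\mid(\tau\theta)\theta=1\}$. *)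

theory Defs
  imports "HOL-Analysis.Analysis" "HOL-Algebra.Bij" "HOL-Algebra.Coset"
begin

text \<open>
  The Cayley algebra is built by doubling the quaternions, over an arbitrary commutative ring of
  coefficients, so that \<open>real oct\<close> is the division Cayley algebra and \<open>complex oct\<close> is its
  complexification. Coordinate 1 is the scalar part. The type \<^typ>\<open>'a ^ 8\<close> already
  carries the coordinatewise ring structure, so \<open>(*)\<close> and \<open>1\<close> on it (and hence \<open>(**)\<close> and
  \<open>mat 1\<close> on matrices over it) are \<^emph>\<open>not\<close> the octonion operations.
\<close>

type_synonym 'a quat = "'a ^ 4"
type_synonym 'a oct = "'a ^ 8"
type_synonym 'a omat = "'a oct ^ 3 ^ 3"

definition qmult :: "'a::comm_ring_1 quat \<Rightarrow> 'a quat \<Rightarrow> 'a quat" where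
  "qmult a b = vector
    [a$1 * b$1 - a$2 * b$2 - a$3 * b$3 - a$4 * b$4,
     a$1 * b$2 + a$2 * b$1 + a$3 * b$4 - a$4 * b$3,
     a$1 * b$3 - a$2 * b$4 + a$3 * b$1 + a$4 * b$2,
     a$1 * b$4 + a$2 * b$3 - a$3 * b$2 + a$4 * b$1]"

definition qcnj :: "'a::comm_ring_1 quat \<Rightarrow> 'a quat" where
  "qcnj a = vector [a$1, - a$2, - a$3, - a$4]"

definition qfst :: "'a::comm_ring_1 oct \<Rightarrow> 'a quat" where
  "qfst x = vector [x$1, x$2, x$3, x$4]"

definition qsnd :: "'a::comm_ring_1 oct \<Rightarrow> 'a quat" where
  "qsnd x = vector [x$5, x$6, x$7, x$8]"

definition qjoin :: "'a::comm_ring_1 quat \<Rightarrow> 'a quat \<Rightarrow> 'a oct" where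
  "qjoin a b = vector [a$1, a$2, a$3, a$4, b$1, b$2, b$3, b$4]"

definition omult :: "'a::comm_ring_1 oct \<Rightarrow> 'a oct \<Rightarrow> 'a oct" where
  "omult x y = qjoin
     (qmult (qfst x) (qfst y) - qmult (qcnj (qsnd y)) (qsnd x))
     (qmult (qsnd x) (qcnj (qfst y)) + qmult (qsnd y) (qfst x))"

definition ocnj :: "'a::comm_ring_1 oct \<Rightarrow> 'a oct" where
  "ocnj x = qjoin (qcnj (qfst x)) (- qsnd x)"

definition oone :: "'a::comm_ring_1 oct" where
  "oone = axis 1 1"

definition omat_mult :: "'a::comm_ring_1 omat \<Rightarrow> 'a omat \<Rightarrow> 'a omat" where
  "omat_mult X Y = (\<chi> i j. \<Sum>k\<in>UNIV. omult (X$i$k) (Y$k$j))"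

definition omat_adj :: "'a::comm_ring_1 omat \<Rightarrow> 'a omat" where
  "omat_adj X = (\<chi> i j. ocnj (X$j$i))"

definition hmat :: "'a::comm_ring_1 \<Rightarrow> 'a \<Rightarrow> 'a \<Rightarrow> 'a oct \<Rightarrow> 'a oct \<Rightarrow> 'a oct \<Rightarrow> 'a omat" where
  "hmat \<xi>1 \<xi>2 \<xi>3 x1 x2 x3 = vector
     [vector [\<xi>1 *s oone, x3, ocnj x2],
      vector [ocnj x3, \<xi>2 *s oone, x1],
      vector [x2, ocnj x1, \<xi>3 *s oone]]"

definition Jreal :: "real omat set" where
  "Jreal = {X. omat_adj X = X}"

definition cplx :: "real omat \<Rightarrow> complex omat" where
  "cplx X = (\<chi> i j k. complex_of_real (X$i$j$k))"

definition cscale :: "complex \<Rightarrow> complex omat \<Rightarrow> complex omat" where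
  "cscale c X = (\<chi> i j. c *s (X$i$j))"

definition JC :: "complex omat set" where
  "JC = {cplx X + cscale \<i> (cplx Y) | X Y. X \<in> Jreal \<and> Y \<in> Jreal}"

definition tau :: "complex omat \<Rightarrow> complex omat" where
  "tau X = (\<chi> i j k. cnj (X$i$j$k))"

definition jmult :: "complex omat \<Rightarrow> complex omat \<Rightarrow> complex omat" where
  "jmult X Y = cscale (1/2) (omat_mult X Y + omat_mult Y X)"

text \<open>On \<open>JC\<close> the diagonal entries are scalar multiples of \<open>oone\<close>; the trace is taken as a scalar.\<close>

definition jtr :: "complex omat \<Rightarrow> complex" where
  "jtr X = (\<Sum>i\<in>UNIV. X$i$i$1)"

definition jinner :: "complex omat \<Rightarrow> complex omat \<Rightarrow> complex" where
  "jinner X Y = jtr (jmult X Y)"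

definition jone :: "complex omat" where
  "jone = hmat 1 1 1 0 0 0"

definition jcross :: "complex omat \<Rightarrow> complex omat \<Rightarrow> complex omat" where
  "jcross X Y = cscale (1/2)
     (cscale 2 (jmult X Y) - cscale (jtr X) Y - cscale (jtr Y) X
      + cscale (jtr X * jtr Y - jinner X Y) jone)"

definition jdet :: "complex omat \<Rightarrow> complex" where
  "jdet X = 1/3 * jinner X (jcross X X)"

definition jherm :: "complex omat \<Rightarrow> complex omat \<Rightarrow> complex" where
  "jherm X Y = jinner (tau X) Y"

text \<open>
  Self-maps of \<open>JC\<close> are represented by functions on the matrix type that are undefined outside
  \<open>JC\<close>, as in \<^const>\<open>BijGroup\<close>.
\<close>

definition E6 :: "(complex omat \<Rightarrow> complex omat) monoid" where
  "E6 = BijGroup JC \<lparr> carrier :=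
     {\<alpha> \<in> Bij JC.
        (\<forall>X\<in>JC. \<forall>Y\<in>JC. \<alpha> (X + Y) = \<alpha> X + \<alpha> Y) \<and>
        (\<forall>c. \<forall>X\<in>JC. \<alpha> (cscale c X) = cscale c (\<alpha> X)) \<and>
        (\<forall>X\<in>JC. jdet (\<alpha> X) = jdet X) \<and>
        (\<forall>X\<in>JC. \<forall>Y\<in>JC. jherm (\<alpha> X) (\<alpha> Y) = jherm X Y)} \<rparr>"

definition jsigma :: "complex omat \<Rightarrow> complex omat" where
  "jsigma = (\<lambda>X\<in>JC. hmat (X$1$1$1) (X$2$2$1) (X$3$3$1) (X$2$3) (- (X$3$1)) (- (X$1$2)))"

definition jsigma' :: "complex omat \<Rightarrow> complex omat" where
  "jsigma' = (\<lambda>X\<in>JC. hmat (X$1$1$1) (X$2$2$1) (X$3$3$1) (- (X$2$3)) (- (X$3$1)) (X$1$2))"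

definition E6_fix :: "(complex omat \<Rightarrow> complex omat) \<Rightarrow> (complex omat \<Rightarrow> complex omat) set" where
  "E6_fix s = {\<alpha> \<in> carrier E6. s \<otimes>\<^bsub>E6\<^esub> \<alpha> \<otimes>\<^bsub>E6\<^esub> s = \<alpha>}"

definition SO8 :: "(real^8^8) monoid" where
  "SO8 = \<lparr> carrier = {A. rotation_matrix A}, mult = (**), one = mat 1 \<rparr>"

definition Spin8 :: "((real^8^8) \<times> (real^8^8) \<times> (real^8^8)) monoid" where
  "Spin8 = (SO8 \<times>\<times> SO8 \<times>\<times> SO8) \<lparr> carrier :=
     {(A1, A2, A3). A1 \<in> carrier SO8 \<and> A2 \<in> carrier SO8 \<and> A3 \<in> carrier SO8 \<and>
        (\<forall>x y. omult (A1 *v x) (A2 *v y) = ocnj (A3 *v ocnj (omult x y)))} \<rparr>"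

definition spin_act :: "(real^8^8) \<times> (real^8^8) \<times> (real^8^8) \<Rightarrow> complex omat \<Rightarrow> complex omat" where
  "spin_act = (\<lambda>(A1, A2, A3). \<lambda>X\<in>JC. hmat (X$1$1$1) (X$2$2$1) (X$3$3$1)
     (map_matrix complex_of_real A1 *v (X$2$3))
     (map_matrix complex_of_real A2 *v (X$3$1))
     (map_matrix complex_of_real A3 *v (X$1$2)))"

definition sigma_spin :: "(real^8^8) \<times> (real^8^8) \<times> (real^8^8)" where
  "sigma_spin = (mat 1, - mat 1, - mat 1)"

definition sigma'_spin :: "(real^8^8) \<times> (real^8^8) \<times> (real^8^8)" where
  "sigma'_spin = (- mat 1, - mat 1, mat 1)"

definition U1 :: "complex monoid" where
  "U1 = \<lparr> carrier = {\<theta>. cnj \<theta> * \<theta> = 1}, mult = (*), one = 1 \<rparr>"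

definition UUSpin :: "(complex \<times> complex \<times> (real^8^8) \<times> (real^8^8) \<times> (real^8^8)) monoid" where
  "UUSpin = U1 \<times>\<times> U1 \<times>\<times> Spin8"

definition Z2 :: "(complex \<times> complex \<times> (real^8^8) \<times> (real^8^8) \<times> (real^8^8)) set" where
  "Z2 = {(1, 1, \<one>\<^bsub>Spin8\<^esub>), (1, -1, sigma_spin)}"

definition Z4 :: "(complex \<times> complex \<times> (real^8^8) \<times> (real^8^8) \<times> (real^8^8)) set" where
  "Z4 = {(1, 1, \<one>\<^bsub>Spin8\<^esub>), (-\<i>, \<i>, sigma'_spin), (-1, -1, \<one>\<^bsub>Spin8\<^esub>), (\<i>, -\<i>, sigma'_spin)}"

text \<open>The quotient topology on the cosets of \<open>N\<close>, for a topology \<open>T\<close> on the carrier of \<open>G\<close>.\<close>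

definition coset_topology :: "('a, 'b) monoid_scheme \<Rightarrow> 'a topology \<Rightarrow> 'a set \<Rightarrow> 'a set topology" where
  "coset_topology G T N = topology
     (\<lambda>U. U \<subseteq> carrier (G Mod N) \<and> openin T {g \<in> topspace T. N #>\<^bsub>G\<^esub> g \<in> U})"

text \<open>Isomorphism of topological groups; for compact Lie groups this is Lie group isomorphism.\<close>

definition top_group_iso ::
  "('a, 'b) monoid_scheme \<Rightarrow> 'a topology \<Rightarrow> ('c, 'd) monoid_scheme \<Rightarrow> 'c topology \<Rightarrow> bool" where
  "top_group_iso G T H S \<longleftrightarrow> (\<exists>f \<in> iso G H. homeomorphic_map T S f)"

lemma openin_coset_topology:
  "openin (coset_topology G T N) U \<longleftrightarrow>
     U \<subseteq> carrier (G Mod N) \<and> openin T {g \<in> topspace T. N #>\<^bsub>G\<^esub> g \<in> U}"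
proof -
  let ?P = "\<lambda>U. U \<subseteq> carrier (G Mod N) \<and> openin T {g \<in> topspace T. N #>\<^bsub>G\<^esub> g \<in> U}"
  have "istopology ?P"
    unfolding istopology_def
  proof (intro conjI allI impI)
    fix U V assume "?P U" "?P V"
    moreover have "{g \<in> topspace T. N #>\<^bsub>G\<^esub> g \<in> U \<inter> V} =
      {g \<in> topspace T. N #>\<^bsub>G\<^esub> g \<in> U} \<inter> {g \<in> topspace T. N #>\<^bsub>G\<^esub> g \<in> V}" by auto
    ultimately show "U \<inter> V \<subseteq> carrier (G Mod N)"
      and "openin T {g \<in> topspace T. N #>\<^bsub>G\<^esub> g \<in> U \<inter> V}" by auto
  next
    fix K assume K: "\<forall>U\<in>K. ?P U"
    have "{g \<in> topspace T. N #>\<^bsub>G\<^esub> g \<in> \<Union>K} = (\<Union>U\<in>K. {g \<in> topspace T. N #>\<^bsub>G\<^esub> g \<in> U})" by auto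
    with K show "openin T {g \<in> topspace T. N #>\<^bsub>G\<^esub> g \<in> \<Union>K}" by auto
    from K show "\<Union>K \<subseteq> carrier (G Mod N)" by blast
  qed
  then show ?thesis by (simp add: coset_topology_def)
qed

lemma exhaust_8: "x = 1 \<or> x = 2 \<or> x = 3 \<or> x = 4 \<or> x = 5 \<or> x = 6 \<or> x = 7 \<or> x = 8" for x :: 8
proof (induct x)
  case (of_int z)
  then have "z \<in> {0, 1, 2, 3, 4, 5, 6, 7}" by auto
  then show ?case by auto
qed

lemma forall_8: "(\<forall>i::8. P i) \<longleftrightarrow> P 1 \<and> P 2 \<and> P 3 \<and> P 4 \<and> P 5 \<and> P 6 \<and> P 7 \<and> P 8"
  by (metis exhaust_8)

lemma UNIV_8: "UNIV = {1, 2, 3, 4, 5, 6, 7, 8::8}"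
  using exhaust_8 by auto

lemma sum_8: "sum f (UNIV::8 set) = f 1 + f 2 + f 3 + f 4 + f 5 + f 6 + f 7 + f 8"
  unfolding UNIV_8 by (simp add: ac_simps)

lemma vector_4 [simp]:
  "(vector [a, b, c, d] :: 'a::zero^4)$1 = a" "(vector [a, b, c, d] :: 'a^4)$2 = b"
  "(vector [a, b, c, d] :: 'a^4)$3 = c" "(vector [a, b, c, d] :: 'a^4)$4 = d"
  by (simp_all add: vector_def)

lemma vector_8 [simp]:
  "(vector [a, b, c, d, e, f, g, h] :: 'a::zero^8)$1 = a"
  "(vector [a, b, c, d, e, f, g, h] :: 'a^8)$2 = b"
  "(vector [a, b, c, d, e, f, g, h] :: 'a^8)$3 = c"
  "(vector [a, b, c, d, e, f, g, h] :: 'a^8)$4 = d"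
  "(vector [a, b, c, d, e, f, g, h] :: 'a^8)$5 = e"
  "(vector [a, b, c, d, e, f, g, h] :: 'a^8)$6 = f"
  "(vector [a, b, c, d, e, f, g, h] :: 'a^8)$7 = g"
  "(vector [a, b, c, d, e, f, g, h] :: 'a^8)$8 = h"
  by (simp_all add: vector_def)

lemmas oct_unfold = omult_def ocnj_def qmult_def qcnj_def qfst_def qsnd_def qjoin_def

lemma omult_oone [simp]: "omult oone x = x" "omult x oone = x"
  by (simp_all add: vec_eq_iff forall_8 oct_unfold oone_def axis_def)

lemma sumsq_qmult:
  fixes a b :: "'a::comm_ring_1 quat"
  shows "(\<Sum>i\<in>UNIV. (qmult a b $ i)^2) = (\<Sum>i\<in>UNIV. (a$i)^2) * (\<Sum>i\<in>UNIV. (b$i)^2)"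
  by (simp add: sum_4 qmult_def power2_eq_square algebra_simps)

lemma sumsq_omult:
  fixes x y :: "'a::comm_ring_1 oct"
  shows "(\<Sum>i\<in>UNIV. (omult x y $ i)^2) = (\<Sum>i\<in>UNIV. (x$i)^2) * (\<Sum>i\<in>UNIV. (y$i)^2)"
proof -
  define N :: "'a quat \<Rightarrow> 'a" where "N a = (\<Sum>i\<in>UNIV. (a$i)^2)" for a
  define B :: "'a quat \<Rightarrow> 'a quat \<Rightarrow> 'a" where "B a b = (\<Sum>i\<in>UNIV. a$i * b$i)" for a b
  have Nm: "N (qmult a b) = N a * N b" and Nc: "N (qcnj a) = N a" for a b
    by (simp_all add: N_def sumsq_qmult, simp add: sum_4 qcnj_def)
  have Nd: "N (a - b) = N a + N b - 2 * B a b" "N (a + b) = N a + N b + 2 * B a b" for a b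
    by (simp_all add: N_def B_def sum_4 power2_eq_square algebra_simps)
  have Bm: "B (qmult m n) (qmult (qcnj b) a) = B (qmult a (qcnj n)) (qmult b m)" for a b m n
    by (simp add: B_def sum_4 qmult_def qcnj_def algebra_simps)
  have No: "(\<Sum>i\<in>UNIV. (qjoin a b $ i)^2) = N a + N b" for a b
    by (simp add: N_def sum_4 sum_8 qjoin_def)
  have "x = qjoin (qfst x) (qsnd x)" for x :: "'a oct"
    by (simp add: vec_eq_iff forall_8 qjoin_def qfst_def qsnd_def)
  then have Ns: "(\<Sum>i\<in>UNIV. (x $ i)^2) = N (qfst x) + N (qsnd x)" for x :: "'a oct"
    by (metis No)
  show ?thesis
    unfolding Ns[of x] Ns[of y] omult_def No Nd Nm Nc Bm by (simp add: algebra_simps)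
qed

lemma norm_omult: "norm (omult x y) = norm x * norm (y :: real oct)"
  by (simp add: norm_vec_def L2_set_def sumsq_omult real_sqrt_mult)


lemma ocnj_nth [simp]:
  "ocnj x $ i = (if i = 1 then x $ i else - (x $ i))"
proof -
  have "\<forall>i. ocnj x $ i = (if i = 1 then x $ i else - (x $ i))"
    by (simp add: forall_8 oct_unfold)
  then show ?thesis by blast
qed

lemma JC_iff: "X \<in> JC \<longleftrightarrow> omat_adj X = X"
proof
  assume "X \<in> JC"
  then obtain A B where X: "X = cplx A + cscale \<i> (cplx B)" and "A \<in> Jreal" "B \<in> Jreal"
    by (auto simp: JC_def)
  then have "ocnj (A$j$i) = A$i$j" "ocnj (B$j$i) = B$i$j" for i j
    by (auto simp: Jreal_def omat_adj_def vec_eq_iff)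
  then have AB: "A$i$j$k = (if k = 1 then A$j$i$k else - (A$j$i$k))"
       "B$i$j$k = (if k = 1 then B$j$i$k else - (B$j$i$k))" for i j k
    by (metis ocnj_nth)+
  have "omat_adj X $ i $ j $ k = X $ i $ j $ k" for i j k
    unfolding X by (simp add: omat_adj_def cplx_def cscale_def AB[of i j])
  then show "omat_adj X = X" by (simp add: vec_eq_iff)
next
  assume "omat_adj X = X"
  then have "omat_adj X $ i $ j $ k = X $ i $ j $ k" for i j k by simp
  then have *: "(if k = 1 then X$j$i$k else - (X$j$i$k)) = X$i$j$k" for i j k
    by (simp add: omat_adj_def)
  define A B :: "real omat" where "A = (\<chi> i j k. Re (X$i$j$k))" and "B = (\<chi> i j k. Im (X$i$j$k))"
  have "X = cplx A + cscale \<i> (cplx B)"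
    by (simp add: vec_eq_iff cplx_def cscale_def A_def B_def flip: complex_eq)
  moreover have "ocnj (A$j$i) = A$i$j" "ocnj (B$j$i) = B$i$j" for i j
    unfolding vec_eq_iff
    by (rule allI, simp add: A_def B_def flip: *[of _ i j])+
  then have "A \<in> Jreal" "B \<in> Jreal"
    by (simp_all add: Jreal_def omat_adj_def)
  ultimately show "X \<in> JC" by (auto simp: JC_def)
qed

lemma JC_nth: "X \<in> JC \<longleftrightarrow> (\<forall>i j k. (if k = 1 then X$j$i$k else - (X$j$i$k)) = X$i$j$k)"
  by (simp add: JC_iff omat_adj_def vec_eq_iff)

lemma hmat_eq:
  assumes "X \<in> JC"
  shows "X = hmat (X$1$1$1) (X$2$2$1) (X$3$3$1) (X$2$3) (X$3$1) (X$1$2)"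
proof -
  have "omat_adj X $ i $ j = X $ i $ j" for i j using assms by (simp add: JC_iff)
  then have *: "ocnj (X$j$i) = X$i$j" for i j by (simp add: omat_adj_def)
  have "X$i$i$k = 0" if "k \<noteq> 1" for i k
  proof -
    have "ocnj (X$i$i) $ k = X$i$i$k" by (simp only: *)
    with that show ?thesis by simp
  qed
  then have "X$i$i = X$i$i$1 *s oone" for i
    by (simp add: vec_eq_iff oone_def axis_def)
  then have "X = vector [vector [X$1$1$1 *s oone, X$1$2, X$1$3],
    vector [X$2$1, X$2$2$1 *s oone, X$2$3], vector [X$3$1, X$3$2, X$3$3$1 *s oone]]"
    by (simp add: vec_eq_iff[where 'b=3] forall_3)
  then show ?thesis by (simp only: hmat_def *)
qed

lemma hmat_in_JC: "hmat a b c x y z \<in> JC"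
  unfolding JC_iff vec_eq_iff forall_3 hmat_def omat_adj_def
  by (auto simp: oone_def axis_def)

lemma omult_minus [simp]: "omult (- x) y = - omult x y" "omult x (- y) = - omult x y"
  by (simp_all add: vec_eq_iff forall_8 oct_unfold)

lemma spin_act_sigma: "spin_act sigma_spin = jsigma" "spin_act sigma'_spin = jsigma'"
proof -
  have [simp]: "map_matrix complex_of_real (mat 1) *v x = x" for x :: "complex oct"
  proof -
    have "map_matrix complex_of_real (mat 1) = (mat 1 :: complex^8^8)"
      by (simp add: map_matrix_def mat_def vec_eq_iff)
    then show ?thesis by simp
  qed
  have [simp]: "map_matrix complex_of_real (- mat 1) *v x = - x" for x :: "complex oct"
  proof -
    have "map_matrix complex_of_real (- mat 1) *v x = - (map_matrix complex_of_real (mat 1) *v x)"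
      by (simp add: map_matrix_def matrix_vector_mult_def vec_eq_iff sum_negf)
    then show ?thesis by simp
  qed
  show "spin_act sigma_spin = jsigma" "spin_act sigma'_spin = jsigma'"
    by (simp_all add: spin_act_def sigma_spin_def sigma'_spin_def jsigma_def jsigma'_def restrict_def fun_eq_iff)
qed

text \<open>
  Conjugation by the diagonal matrix with entries \<open>d\<close>; with signs on the diagonal this gives
  \<open>jsigma\<close> and \<open>jsigma'\<close>.
\<close>

definition signs :: "complex^3 \<Rightarrow> complex omat \<Rightarrow> complex omat" where
  "signs d X = (\<chi> i j. (d$i * d$j) *s X$i$j)"

lemma omult_scale: "omult (a *s x) y = a *s omult x y" "omult x (a *s y) = a *s omult x y"
  by (simp_all add: vec_eq_iff forall_8 oct_unfold algebra_simps)

lemma signs_JC: "X \<in> JC \<Longrightarrow> signs d X \<in> JC"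
  for d
  unfolding JC_nth
proof (intro allI)
  fix i j k
  assume "\<forall>i j k. (if k = 1 then X$j$i$k else - (X$j$i$k)) = X$i$j$k"
  then have "(if k = 1 then X$j$i$k else - (X$j$i$k)) = X$i$j$k" by blast
  from this[symmetric] show "(if k = 1 then signs d X$j$i$k else - (signs d X$j$i$k)) = signs d X$i$j$k"
    by (cases "k = 1") (simp_all add: signs_def mult.commute)
qed

lemma JC_add: "X \<in> JC \<Longrightarrow> Y \<in> JC \<Longrightarrow> X + Y \<in> JC"
  unfolding JC_nth
proof (intro allI)
  fix i j k
  assume "\<forall>i j k. (if k = 1 then X$j$i$k else - (X$j$i$k)) = X$i$j$k"
    "\<forall>i j k. (if k = 1 then Y$j$i$k else - (Y$j$i$k)) = Y$i$j$k"
  then have "(if k = 1 then X$j$i$k else - (X$j$i$k)) = X$i$j$k"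
    "(if k = 1 then Y$j$i$k else - (Y$j$i$k)) = Y$i$j$k" by blast+
  from this[symmetric] show "(if k = 1 then (X + Y)$j$i$k else - ((X + Y)$j$i$k)) = (X + Y)$i$j$k"
    by (cases "k = 1") simp_all
qed

lemma JC_cscale: "X \<in> JC \<Longrightarrow> cscale c X \<in> JC"
  unfolding JC_nth
proof (intro allI)
  fix i j k
  assume "\<forall>i j k. (if k = 1 then X$j$i$k else - (X$j$i$k)) = X$i$j$k"
  then have "(if k = 1 then X$j$i$k else - (X$j$i$k)) = X$i$j$k" by blast
  from this[symmetric] show "(if k = 1 then cscale c X$j$i$k else - (cscale c X$j$i$k)) = cscale c X$i$j$k"
    by (cases "k = 1") (simp_all add: cscale_def)
qed

context
  fixes d :: "complex^3"
  assumes d: "\<And>i. d$i = 1 \<or> d$i = -1"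
begin

lemma dd: "d$i * d$i = 1" "d$i * (d$i * z) = z" "cnj (d$i) = d$i"
  using d[of i] by auto

lemma signs_signs: "signs d (signs d X) = X"
  by (simp add: signs_def vec_eq_iff algebra_simps dd)

lemma signs_mult: "omat_mult (signs d X) (signs d Y) = signs d (omat_mult X Y)"
proof -
  have *: "d$k * d$j * (d$i * d$k) = d$i * d$j" for i j k
    using d[of k] by auto
  show ?thesis
    by (simp add: signs_def omat_mult_def vec_eq_iff omult_scale sum_distrib_left *)
qed

lemma signs_add: "signs d (X + Y) = signs d X + signs d Y"
   "signs d (X - Y) = signs d X - signs d Y"
   "signs d (cscale c X) = cscale c (signs d X)"
   "signs d (tau X) = tau (signs d X)"
  by (simp_all add: signs_def vec_eq_iff cscale_def tau_def algebra_simps dd)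

lemma signs_tr: "jtr (signs d X) = jtr X"
  by (simp add: signs_def jtr_def dd)

lemma signs_one: "signs d jone = jone"
  by (simp add: signs_def jone_def hmat_def vec_eq_iff forall_3 dd)

lemma signs_jmult: "jmult (signs d X) (signs d Y) = signs d (jmult X Y)"
  by (simp add: jmult_def signs_mult signs_add)

lemma signs_jinner: "jinner (signs d X) (signs d Y) = jinner X Y"
  by (simp add: jinner_def signs_jmult signs_tr)

lemma signs_jcross: "jcross (signs d X) (signs d Y) = signs d (jcross X Y)"
  by (simp only: jcross_def signs_jmult signs_tr signs_jinner signs_add signs_one)

lemma signs_E6: "restrict (signs d) JC \<in> carrier E6"
proof -
  have "bij_betw (restrict (signs d) JC) JC JC"
    by (rule bij_betw_byWitness[where f' = "signs d"]) (auto simp: signs_signs signs_JC)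
  then have "restrict (signs d) JC \<in> Bij JC"
    by (simp add: Bij_def)
  moreover have "jdet (signs d X) = jdet X" for X
    by (simp only: jdet_def signs_jcross signs_jinner)
  moreover have "jherm (signs d X) (signs d Y) = jherm X Y" for X Y
    by (simp only: jherm_def signs_add(4)[symmetric] signs_jinner)
  ultimately show ?thesis
    by (simp add: E6_def JC_add JC_cscale signs_add(1,3))
qed

end

lemma jsigma_eq_signs:
  "jsigma = restrict (signs (vector [1,-1,-1])) JC"
  "jsigma' = restrict (signs (vector [-1,-1,1])) JC"
proof -
  have s: "signs d X = hmat (signs d X$1$1$1) (signs d X$2$2$1) (signs d X$3$3$1)
      (signs d X$2$3) (signs d X$3$1) (signs d X$1$2)" if "X \<in> JC" for d X
    by (rule hmat_eq[OF signs_JC[OF that]])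
  have scale: "1 *s x = x" "-1 *s x = - x" for x :: "complex oct"
    by (simp_all add: vec_eq_iff)
  have e: "signs d X$i$j = (d$i * d$j) *s X$i$j" for d X i j
    by (simp add: signs_def)
  have 1: "jsigma X = signs (vector [1,-1,-1]) X" if "X \<in> JC" for X
    using that by (subst s[OF that], simp add: jsigma_def e scale)
  have 2: "jsigma' X = signs (vector [-1,-1,1]) X" if "X \<in> JC" for X
    using that by (subst s[OF that], simp add: jsigma'_def e scale)
  show "jsigma = restrict (signs (vector [1,-1,-1])) JC"
    by (rule extensionalityI[where A = JC]) (simp add: jsigma_def, simp, simp add: 1)
  show "jsigma' = restrict (signs (vector [-1,-1,1])) JC"
    by (rule extensionalityI[where A = JC]) (simp add: jsigma'_def, simp, simp add: 2)
qed

lemma jsigma_in_E6: "jsigma \<in> carrier E6" "jsigma' \<in> carrier E6"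
proof -
  have "\<forall>i. (vector [1,-1,-1] :: complex^3)$i = 1 \<or> (vector [1,-1,-1] :: complex^3)$i = -1"
     "\<forall>i. (vector [-1,-1,1] :: complex^3)$i = 1 \<or> (vector [-1,-1,1] :: complex^3)$i = -1"
    by (simp_all add: forall_3)
  then show "jsigma \<in> carrier E6" "jsigma' \<in> carrier E6"
    unfolding jsigma_eq_signs by (simp_all only: signs_E6)
qed


lemma group_SO8: "group SO8"
proof (rule groupI)
  fix A B assume "A \<in> carrier SO8" "B \<in> carrier SO8"
  then show "A \<otimes>\<^bsub>SO8\<^esub> B \<in> carrier SO8"
    by (simp add: SO8_def rotation_matrix_def orthogonal_matrix_mul det_mul)
next
  fix A assume "A \<in> carrier SO8"
  then show "\<exists>B\<in>carrier SO8. B \<otimes>\<^bsub>SO8\<^esub> A = \<one>\<^bsub>SO8\<^esub>"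
    by (intro bexI[of _ "transpose A"]) (auto simp: SO8_def rotation_matrix_def orthogonal_matrix_def)
qed (simp_all add: SO8_def rotation_matrix_def orthogonal_matrix_id matrix_mul_assoc)

lemma ocnj_ocnj [simp]: "ocnj (ocnj x) = x"
  by (simp add: vec_eq_iff)

lemma subgroup_Spin8: "subgroup (carrier Spin8) (SO8 \<times>\<times> SO8 \<times>\<times> SO8)"
proof -
  interpret SO8: group SO8 by (rule group_SO8)
  interpret S2: group "SO8 \<times>\<times> SO8" by (intro DirProd_group group_SO8)
  interpret S3: group "SO8 \<times>\<times> SO8 \<times>\<times> SO8" by (intro DirProd_group group_SO8)
  have so: "A ** B \<in> carrier SO8" if "A \<in> carrier SO8" "B \<in> carrier SO8" for A B
    using SO8.m_closed[OF that] by (simp add: SO8_def)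
  have inv: "inv\<^bsub>SO8\<^esub> A *v (A *v x) = x" "A *v (inv\<^bsub>SO8\<^esub> A *v x) = x" if "A \<in> carrier SO8" for A x
    using SO8.l_inv[OF that] SO8.r_inv[OF that]
    by (simp_all add: SO8_def matrix_vector_mul_assoc)
  show ?thesis
  proof (rule S3.subgroupI)
    show "carrier Spin8 \<subseteq> carrier (SO8 \<times>\<times> SO8 \<times>\<times> SO8)" by (auto simp: Spin8_def)
    have "(mat 1, mat 1, mat 1) \<in> carrier Spin8"
      using SO8.one_closed by (simp add: Spin8_def SO8_def)
    then show "carrier Spin8 \<noteq> {}" by blast
  next
    fix a assume "a \<in> carrier Spin8"
    then obtain A B C where a: "a = (A, B, C)"
      and s: "A \<in> carrier SO8" "B \<in> carrier SO8" "C \<in> carrier SO8"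
      and t: "\<And>x y. omult (A *v x) (B *v y) = ocnj (C *v ocnj (omult x y))"
      by (auto simp: Spin8_def)
    have "omult (inv\<^bsub>SO8\<^esub> A *v x) (inv\<^bsub>SO8\<^esub> B *v y) = ocnj (inv\<^bsub>SO8\<^esub> C *v ocnj (omult x y))" for x y
    proof -
      have "omult x y = ocnj (C *v ocnj (omult (inv\<^bsub>SO8\<^esub> A *v x) (inv\<^bsub>SO8\<^esub> B *v y)))"
        by (simp add: inv s flip: t)
      then show ?thesis by (simp add: inv s)
    qed
    then show "inv\<^bsub>SO8 \<times>\<times> SO8 \<times>\<times> SO8\<^esub> a \<in> carrier Spin8"
      using s by (simp add: a Spin8_def inv_DirProd group_SO8 DirProd_group)
  next
    fix a b assume "a \<in> carrier Spin8" "b \<in> carrier Spin8"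
    then show "a \<otimes>\<^bsub>SO8 \<times>\<times> SO8 \<times>\<times> SO8\<^esub> b \<in> carrier Spin8"
      by (auto simp: Spin8_def SO8.m_closed) (simp add: SO8_def flip: matrix_vector_mul_assoc)
  qed
qed

lemma group_Spin8: "group Spin8"
proof -
  have "group ((SO8 \<times>\<times> SO8 \<times>\<times> SO8) \<lparr>carrier := carrier Spin8\<rparr>)"
    by (intro subgroup.subgroup_is_group subgroup_Spin8 DirProd_group group_SO8)
  then show ?thesis by (simp add: Spin8_def)
qed

lemma group_U1: "group U1"
proof (rule groupI)
  fix a assume "a \<in> carrier U1"
  then show "\<exists>b\<in>carrier U1. b \<otimes>\<^bsub>U1\<^esub> a = \<one>\<^bsub>U1\<^esub>"
    by (intro bexI[of _ "cnj a"]) (auto simp: U1_def mult.commute)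
next
  fix a b assume "a \<in> carrier U1" "b \<in> carrier U1"
  then have "cnj a * a = 1" "cnj b * b = 1" by (simp_all add: U1_def)
  then have "(cnj a * a) * (cnj b * b) = 1" by simp
  then show "a \<otimes>\<^bsub>U1\<^esub> b \<in> carrier U1" by (simp add: U1_def ac_simps)
qed (simp_all add: U1_def mult.assoc)

lemma group_UUSpin: "group UUSpin"
  unfolding UUSpin_def by (intro DirProd_group group_U1 group_Spin8)

lemma UUSpin_simps:
  "\<one>\<^bsub>Spin8\<^esub> = (mat 1, mat 1, mat 1)"
  "\<one>\<^bsub>UUSpin\<^esub> = (1, 1, mat 1, mat 1, mat 1)"
  "(a, b, A, B, C) \<otimes>\<^bsub>UUSpin\<^esub> (a', b', A', B', C') = (a * a', b * b', A ** A', B ** B', C ** C')"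
  by (simp_all add: UUSpin_def Spin8_def U1_def SO8_def DirProd_def)


lemma minus_mat_1 [simp]:
  "- mat 1 *v x = - x" "- mat 1 ** A = - A" "A ** - mat 1 = - A"
  for A :: "real^8^8" and x :: "real^8"
proof -
  have m: "(- A) ** B = - (A ** B)" "A ** (- B) = - (A ** B)" "(- A) *v x = - (A *v x)"
    for A B :: "real^8^8" and x :: "real^8"
    by (simp_all add: matrix_matrix_mult_def matrix_vector_mult_def vec_eq_iff sum_negf)
  show "- mat 1 *v x = - x" "- mat 1 ** A = - A" "A ** - mat 1 = - A"
    by (simp_all add: m)
qed

lemma sigma_spin_in_Spin8: "sigma_spin \<in> carrier Spin8" "sigma'_spin \<in> carrier Spin8"
proof -
  have "det (- mat 1 :: real^8^8) = (\<Prod>i\<in>UNIV. (- mat 1 :: real^8^8)$i$i)"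
    by (rule det_diagonal) (simp add: mat_def)
  then have "det (- mat 1 :: real^8^8) = 1"
    by (simp add: mat_def)
  moreover have tr: "transpose (- mat 1) = (- mat 1 :: real^8^8)"
    by (simp add: transpose_def mat_def vec_eq_iff)
  ultimately have "- mat 1 \<in> carrier SO8" "mat 1 \<in> carrier SO8"
    by (simp_all add: SO8_def rotation_matrix_def orthogonal_matrix tr)
  moreover have "ocnj (- x) = - ocnj x" for x :: "real oct"
    by (simp add: vec_eq_iff)
  ultimately show "sigma_spin \<in> carrier Spin8" "sigma'_spin \<in> carrier Spin8"
    by (simp_all add: Spin8_def sigma_spin_def sigma'_spin_def)
qed

lemma Z_central:
  assumes "z \<in> Z2 \<or> z \<in> Z4"
  shows "z \<in> carrier UUSpin" "g \<otimes>\<^bsub>UUSpin\<^esub> z = z \<otimes>\<^bsub>UUSpin\<^esub> g"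
proof -
  have "\<one>\<^bsub>Spin8\<^esub> \<in> carrier Spin8"
    by (rule monoid.one_closed[OF group.is_monoid[OF group_Spin8]])
  with assms sigma_spin_in_Spin8 show "z \<in> carrier UUSpin"
    by (auto simp: UUSpin_def U1_def Z2_def Z4_def)
  obtain a b A B C where "g = (a, b, A, B, C)" by (metis prod.exhaust)
  with assms show "g \<otimes>\<^bsub>UUSpin\<^esub> z = z \<otimes>\<^bsub>UUSpin\<^esub> g"
    by (auto simp: Z2_def Z4_def sigma_spin_def sigma'_spin_def UUSpin_simps)
qed

lemma Z_subgroups: "subgroup Z2 UUSpin" "subgroup Z4 UUSpin"
proof -
  interpret G: group UUSpin by (rule group_UUSpin)
  have closed: "x \<otimes>\<^bsub>UUSpin\<^esub> y \<in> Z2" if "x \<in> Z2" "y \<in> Z2" for x y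
    using that by (auto simp: Z2_def sigma_spin_def UUSpin_simps)
  have closed': "x \<otimes>\<^bsub>UUSpin\<^esub> y \<in> Z4" if "x \<in> Z4" "y \<in> Z4" for x y
    using that by (auto simp: Z4_def sigma'_spin_def UUSpin_simps)
  have inv: "\<exists>y\<in>Z2. y \<otimes>\<^bsub>UUSpin\<^esub> x = \<one>\<^bsub>UUSpin\<^esub>" if "x \<in> Z2" for x
    using that by (auto simp: Z2_def sigma_spin_def UUSpin_simps)
  have inv': "\<exists>y\<in>Z4. y \<otimes>\<^bsub>UUSpin\<^esub> x = \<one>\<^bsub>UUSpin\<^esub>" if "x \<in> Z4" for x
    using that by (auto simp: Z4_def sigma'_spin_def UUSpin_simps)
  have iff: "inv\<^bsub>UUSpin\<^esub> x \<in> Z" if x: "x \<in> Z" and Z: "Z = Z2 \<or> Z = Z4"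
    and ex: "\<And>x. x \<in> Z \<Longrightarrow> \<exists>y\<in>Z. y \<otimes>\<^bsub>UUSpin\<^esub> x = \<one>\<^bsub>UUSpin\<^esub>" for x Z
  proof -
    obtain y where y: "y \<in> Z" "y \<otimes>\<^bsub>UUSpin\<^esub> x = \<one>\<^bsub>UUSpin\<^esub>" using ex[OF x] by blast
    with x Z have "inv\<^bsub>UUSpin\<^esub> x = y"
      by (intro G.inv_equality) (auto simp: Z_central(1))
    with y show ?thesis by simp
  qed
  show "subgroup Z2 UUSpin"
    using Z_central(1) by (intro G.subgroupI iff[OF _ _ inv] closed) (auto simp: Z2_def)
  show "subgroup Z4 UUSpin"
    using Z_central(1) by (intro G.subgroupI iff[OF _ _ inv'] closed') (auto simp: Z4_def)
qed

lemma Z2_Int_Z4: "Z2 \<inter> Z4 = {\<one>\<^bsub>UUSpin\<^esub>}"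
  by (auto simp: Z2_def Z4_def UUSpin_simps sigma_spin_def sigma'_spin_def complex_eq_iff)

lemma Z2_Z4_normal: "Z2 <#>\<^bsub>UUSpin\<^esub> Z4 \<lhd> UUSpin"
proof -
  interpret G: group UUSpin by (rule group_UUSpin)
  let ?N = "Z2 <#>\<^bsub>UUSpin\<^esub> Z4"
  have N: "\<exists>z\<in>Z2. \<exists>w\<in>Z4. n = z \<otimes>\<^bsub>UUSpin\<^esub> w" if "n \<in> ?N" for n
    using that by (auto simp: set_mult_def)
  have N': "z \<otimes>\<^bsub>UUSpin\<^esub> w \<in> ?N" if "z \<in> Z2" "w \<in> Z4" for z w
    using that by (auto simp: set_mult_def)
  note c = Z_central(1)[OF disjI1] Z_central(1)[OF disjI2]
  have "subgroup ?N UUSpin"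
  proof (rule G.subgroupI)
    show "?N \<subseteq> carrier UUSpin" using c by (auto simp: set_mult_def)
    show "?N \<noteq> {}" by (auto simp: set_mult_def Z2_def Z4_def)
  next
    fix n assume "n \<in> ?N"
    then obtain z w where n: "z \<in> Z2" "w \<in> Z4" "n = z \<otimes>\<^bsub>UUSpin\<^esub> w" using N by blast
    then have i: "inv\<^bsub>UUSpin\<^esub> z \<in> Z2" "inv\<^bsub>UUSpin\<^esub> w \<in> Z4"
      using Z_subgroups by (auto intro: subgroup.m_inv_closed)
    have "inv\<^bsub>UUSpin\<^esub> n = inv\<^bsub>UUSpin\<^esub> w \<otimes>\<^bsub>UUSpin\<^esub> inv\<^bsub>UUSpin\<^esub> z"
      using n c by (simp add: G.inv_mult_group)
    also have "\<dots> = inv\<^bsub>UUSpin\<^esub> z \<otimes>\<^bsub>UUSpin\<^esub> inv\<^bsub>UUSpin\<^esub> w"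
      by (rule Z_central(2)) (simp add: i)
    finally show "inv\<^bsub>UUSpin\<^esub> n \<in> ?N" using i N' by simp
  next
    fix m n assume "m \<in> ?N" "n \<in> ?N"
    then obtain z w z' w' where m: "z \<in> Z2" "w \<in> Z4" "m = z \<otimes>\<^bsub>UUSpin\<^esub> w"
      and n: "z' \<in> Z2" "w' \<in> Z4" "n = z' \<otimes>\<^bsub>UUSpin\<^esub> w'" using N by metis
    have "m \<otimes>\<^bsub>UUSpin\<^esub> n = z \<otimes>\<^bsub>UUSpin\<^esub> (w \<otimes>\<^bsub>UUSpin\<^esub> z') \<otimes>\<^bsub>UUSpin\<^esub> w'"
      using m n c by (simp add: G.m_assoc)
    also have "w \<otimes>\<^bsub>UUSpin\<^esub> z' = z' \<otimes>\<^bsub>UUSpin\<^esub> w"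
      by (rule Z_central(2)) (simp add: n)
    also have "z \<otimes>\<^bsub>UUSpin\<^esub> (z' \<otimes>\<^bsub>UUSpin\<^esub> w) \<otimes>\<^bsub>UUSpin\<^esub> w' = (z \<otimes>\<^bsub>UUSpin\<^esub> z') \<otimes>\<^bsub>UUSpin\<^esub> (w \<otimes>\<^bsub>UUSpin\<^esub> w')"
      using m n c by (simp add: G.m_assoc)
    finally show "m \<otimes>\<^bsub>UUSpin\<^esub> n \<in> ?N"
      using m n Z_subgroups N' by (simp add: subgroup.m_closed)
  qed
  moreover have "g \<otimes>\<^bsub>UUSpin\<^esub> n \<otimes>\<^bsub>UUSpin\<^esub> inv\<^bsub>UUSpin\<^esub> g \<in> ?N" if g: "g \<in> carrier UUSpin" and "n \<in> ?N" for g n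
  proof -
    obtain z w where n: "z \<in> Z2" "w \<in> Z4" "n = z \<otimes>\<^bsub>UUSpin\<^esub> w" using N \<open>n \<in> ?N\<close> by blast
    have "g \<otimes>\<^bsub>UUSpin\<^esub> n = (g \<otimes>\<^bsub>UUSpin\<^esub> z) \<otimes>\<^bsub>UUSpin\<^esub> w"
      using n c g by (simp add: G.m_assoc)
    also have "g \<otimes>\<^bsub>UUSpin\<^esub> z = z \<otimes>\<^bsub>UUSpin\<^esub> g" using n by (intro Z_central(2)) simp
    also have "z \<otimes>\<^bsub>UUSpin\<^esub> g \<otimes>\<^bsub>UUSpin\<^esub> w = z \<otimes>\<^bsub>UUSpin\<^esub> (g \<otimes>\<^bsub>UUSpin\<^esub> w)"
      using n c g by (simp add: G.m_assoc)
    also have "g \<otimes>\<^bsub>UUSpin\<^esub> w = w \<otimes>\<^bsub>UUSpin\<^esub> g" using n by (intro Z_central(2)) simp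
    finally have "g \<otimes>\<^bsub>UUSpin\<^esub> n = n \<otimes>\<^bsub>UUSpin\<^esub> g" using n c g by (simp add: G.m_assoc)
    then show ?thesis using n c g N' by (simp add: G.m_assoc)
  qed
  ultimately show ?thesis by (rule G.normal_invI)
qed


lemma E6_memI:
  assumes "\<alpha> \<in> Bij JC"
    and "\<And>X Y. X \<in> JC \<Longrightarrow> Y \<in> JC \<Longrightarrow> \<alpha> (X + Y) = \<alpha> X + \<alpha> Y"
    and "\<And>c X. X \<in> JC \<Longrightarrow> \<alpha> (cscale c X) = cscale c (\<alpha> X)"
    and "\<And>X. X \<in> JC \<Longrightarrow> jdet (\<alpha> X) = jdet X"
    and "\<And>X Y. X \<in> JC \<Longrightarrow> Y \<in> JC \<Longrightarrow> jherm (\<alpha> X) (\<alpha> Y) = jherm X Y"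
  shows "\<alpha> \<in> carrier E6"
  using assms by (simp add: E6_def)

lemma E6_memD:
  assumes "\<alpha> \<in> carrier E6"
  shows "\<alpha> \<in> Bij JC" "X \<in> JC \<Longrightarrow> \<alpha> X \<in> JC"
    and "X \<in> JC \<Longrightarrow> Y \<in> JC \<Longrightarrow> \<alpha> (X + Y) = \<alpha> X + \<alpha> Y"
    and "X \<in> JC \<Longrightarrow> \<alpha> (cscale c X) = cscale c (\<alpha> X)"
    and "X \<in> JC \<Longrightarrow> jdet (\<alpha> X) = jdet X"
    and "X \<in> JC \<Longrightarrow> Y \<in> JC \<Longrightarrow> jherm (\<alpha> X) (\<alpha> Y) = jherm X Y"
  using assms by (auto simp: E6_def Bij_def bij_betw_def)

lemma subgroup_E6: "subgroup (carrier E6) (BijGroup JC)"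
proof (rule group.subgroupI[OF group_BijGroup])
  show "carrier E6 \<subseteq> carrier (BijGroup JC)"
    using E6_memD(1) by (auto simp: BijGroup_def)
  show "carrier E6 \<noteq> {}" using jsigma_in_E6 by blast
next
  fix a b assume ab: "a \<in> carrier E6" "b \<in> carrier E6"
  have "a \<otimes>\<^bsub>BijGroup JC\<^esub> b = compose JC a b"
    using ab by (simp add: BijGroup_def E6_memD(1))
  also have "\<dots> \<in> carrier E6"
    using ab by (intro E6_memI compose_Bij)
      (simp_all add: E6_memD compose_eq JC_add JC_cscale)
  finally show "a \<otimes>\<^bsub>BijGroup JC\<^esub> b \<in> carrier E6" .
next
  fix a assume a: "a \<in> carrier E6"
  define b where "b = (\<lambda>X\<in>JC. inv_into JC a X)"
  note aB = E6_memD(1)[OF a]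
  have bB: "b \<in> Bij JC" unfolding b_def by (rule restrict_inv_into_Bij[OF aB])
  have b: "b X \<in> JC" "a (b X) = X" if "X \<in> JC" for X
    using that aB by (auto simp: b_def Bij_inv_into_mem Bij_def bij_betw_def f_inv_into_f)
  have u: "b X = Y" if "Y \<in> JC" "a Y = X" for X Y
    using that aB E6_memD(2)[OF a] by (auto simp: b_def Bij_def bij_betw_def)
  have "inv\<^bsub>BijGroup JC\<^esub> a = b"
    using inv_BijGroup[OF aB] by (simp add: b_def)
  moreover have "b \<in> carrier E6"
  proof (rule E6_memI[OF bB])
    fix X Y assume "X \<in> JC" "Y \<in> JC"
    note b1 = b[OF this(1)] and b2 = b[OF this(2)]
    show "b (X + Y) = b X + b Y"
      using b1 b2 by (intro u) (simp_all add: JC_add E6_memD(3)[OF a])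
    show "b (cscale c X) = cscale c (b X)" for c
      using b1 by (intro u) (simp_all add: JC_cscale E6_memD(4)[OF a])
    show "jdet (b X) = jdet X" using E6_memD(5)[OF a b1(1)] b1 by simp
    show "jherm (b X) (b Y) = jherm X Y" using E6_memD(6)[OF a b1(1) b2(1)] b1 b2 by simp
  qed
  ultimately show "inv\<^bsub>BijGroup JC\<^esub> a \<in> carrier E6" by simp
qed

lemma group_E6: "group E6"
proof -
  have "group (BijGroup JC \<lparr>carrier := carrier E6\<rparr>)"
    by (rule subgroup.subgroup_is_group[OF subgroup_E6 group_BijGroup])
  then show ?thesis by (simp add: E6_def)
qed

end

theory Submission
  imports Defs
begin

text \<open>
  The determinant of an element of the Jordan algebra is
  \<open>\<xi>\<^sub>1\<xi>\<^sub>2\<xi>\<^sub>3 + 2 Re(x\<^sub>1x\<^sub>2x\<^sub>3) - \<Sum> \<xi>\<^sub>k N(x\<^sub>k)\<close>. A map in \<open>E\<^sub>6\<close> that commutes with both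
  involutions preserves the diagonal and each of the three octonion coordinates, and comparing
  determinants shows that it multiplies \<open>\<xi>\<^sub>k\<close> by a unit complex number \<open>d\<^sub>k\<close> and acts on \<open>x\<^sub>k\<close> by a
  unitary map \<open>M\<^sub>k\<close> with \<open>d\<^sub>k N(M\<^sub>k x) = N(x)\<close>. Dividing \<open>M\<^sub>k\<close> by a square root of \<open>1 / d\<^sub>k\<close> makes it
  unitary and complex orthogonal, hence real. With \<open>\<theta>\<^sup>4 = d\<^sub>1\<close> and \<open>\<nu>\<^sup>2 = \<theta>\<^sup>2 d\<^sub>2\<close> the roots can be chosen
  with product 1, and then the three real maps preserve \<open>Re(x\<^sub>1x\<^sub>2x\<^sub>3)\<close>. Such maps have determinant 1:
  an orthogonal map is a product of reflections, and an odd number of them would make the octonion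
  conjugation part of a triality triple, which noncommutativity forbids. So \<open>(\<theta>, \<nu>, \<beta>)\<close> maps onto the
  fixed group, and the kernel is found by solving \<open>\<theta>\<^sup>4 = 1\<close>, \<open>\<nu>\<^sup>2 = \<theta>\<^sup>2\<close>. A continuous bijection
  from a compact space to a Hausdorff space is a homeomorphism.
\<close>

section \<open>Octonion bilinear and trilinear forms\<close>

text \<open>Bilinear even over complex coefficients: no argument is conjugated. The Hermitian form
  is obtained by conjugating the coordinates of the first argument with \<open>ccnj\<close>.\<close>

definition odot :: "'a::comm_ring_1 oct \<Rightarrow> 'a oct \<Rightarrow> 'a" where
  "odot x y = (\<Sum>i\<in>UNIV. x$i * y$i)"

text \<open>The scalar part of \<open>(xy)z\<close>, which is the trilinear term of the
  determinant.\<close>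

definition oform :: "'a::comm_ring_1 oct \<Rightarrow> 'a oct \<Rightarrow> 'a oct \<Rightarrow> 'a" where
  "oform x y z = omult (omult x y) z $ 1"

lemma odot_commute: "odot x y = odot y x"
  by (simp add: odot_def mult.commute)

lemma odot_add: "odot (x + y) z = odot x z + odot y z" "odot z (x + y) = odot z x + odot z y"
  by (simp_all add: odot_def distrib_left distrib_right sum.distrib)

lemma odot_scale: "odot (c *s x) y = c * odot x y" "odot x (c *s y) = c * odot x y"
  by (simp_all add: odot_def sum_distrib_left ac_simps)

lemma odot_zero [simp]: "odot 0 x = 0" "odot x 0 = 0"
  by (simp_all add: odot_def)

lemma odot_axis: "odot (axis i 1) x = x $ i"
proof -
  have "(\<Sum>j\<in>UNIV. axis i 1 $ j * x $ j) = (\<Sum>j\<in>UNIV. if j = i then x $ j else 0)"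
    by (rule sum.cong) (auto simp: axis_def)
  then show ?thesis by (simp add: odot_def)
qed

lemma odot_ext: "(\<And>z. odot x z = odot y z) \<Longrightarrow> x = y"
  by (simp add: vec_eq_iff) (metis odot_axis odot_commute)

lemma omult_add: "omult (x + y) z = omult x z + omult y z" "omult z (x + y) = omult z x + omult z y"
  by (simp_all add: vec_eq_iff forall_8 oct_unfold algebra_simps)

lemma omult_zero [simp]: "omult 0 x = 0" "omult x 0 = 0"
  by (simp_all add: vec_eq_iff forall_8 oct_unfold)

lemma ocnj_add: "ocnj (x + y) = ocnj x + ocnj y"
  by (simp add: vec_eq_iff)

lemma ocnj_scale: "ocnj (c *s x) = c *s ocnj x"
  by (simp add: vec_eq_iff)

lemma ocnj_zero [simp]: "ocnj 0 = 0"
  by (simp add: vec_eq_iff)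

lemma ocnj_omult: "ocnj (omult x y) = omult (ocnj y) (ocnj x)"
  by (simp add: vec_eq_iff forall_8 oct_unfold algebra_simps)

lemma omult_ocnj: "omult x (ocnj x) = odot x x *s oone" "omult (ocnj x) x = odot x x *s oone"
  by (simp_all add: vec_eq_iff forall_8 oct_unfold oone_def axis_def odot_def sum_8 algebra_simps)

lemma omult_nth_1: "omult x y $ 1 = odot x (ocnj y)"
  by (simp add: oct_unfold odot_def sum_8 algebra_simps)

lemma odot_ocnj [simp]: "odot (ocnj x) (ocnj y) = odot x y"
  by (auto simp: odot_def intro: sum.cong)

lemma oform_odot: "oform x y z = odot (omult x y) (ocnj z)"
  by (simp add: oform_def omult_nth_1)

text \<open>Checked in coordinates. This symmetry lets any fact about the first of three triality
  components be carried over to the other two.\<close>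

lemma oform_cyclic: "oform x y z = oform y z x"
  by (simp add: oform_def oct_unfold algebra_simps)

section \<open>Coordinate formulas in the Jordan algebra\<close>

lemma hmat_nth [simp]:
  "hmat a b c x y z $ 1 $ 1 = a *s oone" "hmat a b c x y z $ 2 $ 2 = b *s oone"
  "hmat a b c x y z $ 3 $ 3 = c *s oone"
  "hmat a b c x y z $ 1 $ 2 = z" "hmat a b c x y z $ 2 $ 1 = ocnj z"
  "hmat a b c x y z $ 2 $ 3 = x" "hmat a b c x y z $ 3 $ 2 = ocnj x"
  "hmat a b c x y z $ 3 $ 1 = y" "hmat a b c x y z $ 1 $ 3 = ocnj y"
  by (simp_all add: hmat_def)

lemma oone_1 [simp]: "oone $ 1 = 1"
  by (simp add: oone_def)

lemma hmat_eq_iff: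
  "hmat a b c x y z = hmat a' b' c' x' y' z' \<longleftrightarrow>
     a = a' \<and> b = b' \<and> c = c' \<and> x = x' \<and> y = y' \<and> z = z'"
proof
  let ?H = "hmat a b c x y z" and ?H' = "hmat a' b' c' x' y' z'"
  assume "?H = ?H'"
  then have "?H$1$1$1 = ?H'$1$1$1" "?H$2$2$1 = ?H'$2$2$1" "?H$3$3$1 = ?H'$3$3$1"
    "?H$2$3 = ?H'$2$3" "?H$3$1 = ?H'$3$1" "?H$1$2 = ?H'$1$2" by simp_all
  then show "a = a' \<and> b = b' \<and> c = c' \<and> x = x' \<and> y = y' \<and> z = z'" by simp
qed simp

lemma JC_cases:
  assumes "X \<in> JC"
  obtains a b c x y z where "X = hmat a b c x y z"
  using hmat_eq[OF assms] by blast

lemma hmat_add: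
  "hmat a b c x y z + hmat a' b' c' x' y' z' = hmat (a+a') (b+b') (c+c') (x+x') (y+y') (z+z')"
  by (simp add: vec_eq_iff[where 'b=3] forall_3 vector_sadd_rdistrib ocnj_add)

lemma cscale_hmat: "cscale k (hmat a b c x y z) = hmat (k*a) (k*b) (k*c) (k *s x) (k *s y) (k *s z)"
  by (simp add: vec_eq_iff[where 'b=3] forall_3 cscale_def ocnj_scale)

lemma hmat_minus:
  "hmat a b c x y z - hmat a' b' c' x' y' z' = hmat (a-a') (b-b') (c-c') (x-x') (y-y') (z-z')"
  using hmat_add[of "a-a'" "b-b'" "c-c'" "x-x'" "y-y'" "z-z'" a' b' c' x' y' z']
  by (simp add: algebra_simps)

definition ccnj :: "complex oct \<Rightarrow> complex oct" where
  "ccnj x = (\<chi> i. cnj (x $ i))"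

lemma tau_hmat: "tau (hmat a b c x y z) = hmat (cnj a) (cnj b) (cnj c) (ccnj x) (ccnj y) (ccnj z)"
  by (simp add: vec_eq_iff forall_3 tau_def ccnj_def oone_def axis_def)

lemma jtr_hmat [simp]: "jtr (hmat a b c x y z) = a + b + c"
  by (simp add: jtr_def sum_3)

lemma jinner_hmat:
  "jinner (hmat a b c x y z) (hmat a' b' c' x' y' z') =
     a * a' + b * b' + c * c' + 2 * (odot x x' + odot y y' + odot z z')"
proof -
  have J: "jinner X Y = (\<Sum>i\<in>UNIV. \<Sum>k\<in>UNIV. omult (X$i$k) (Y$k$i) $ 1 + omult (Y$i$k) (X$k$i) $ 1) / 2" for X Y
    by (simp add: jinner_def jtr_def jmult_def cscale_def omat_mult_def sum.distrib flip: sum_divide_distrib)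
  have s: "odot (a *s oone) (ocnj (b *s oone)) = a * b" for a b :: complex
    by (simp add: odot_def sum_8 oone_def axis_def)
  have o: "odot (ocnj x) y = odot x (ocnj y)" for x y :: "complex oct"
    by (metis odot_ocnj ocnj_ocnj)
  show ?thesis
    unfolding J sum_3 omult_nth_1 hmat_nth s o ocnj_ocnj
    by (simp add: odot_commute[of x'] odot_commute[of y'] odot_commute[of z'] algebra_simps)
qed

lemma jmult_hmat_self:
  "jmult (hmat a b c x y z) (hmat a b c x y z) =
     hmat (a^2 + odot y y + odot z z) (b^2 + odot x x + odot z z) (c^2 + odot x x + odot y y)
       ((b + c) *s x + ocnj (omult y z)) ((a + c) *s y + ocnj (omult z x)) ((a + b) *s z + ocnj (omult x y))"
proof -
  have "jmult X X = omat_mult X X" for X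
    by (simp add: jmult_def cscale_def vec_eq_iff)
  moreover have "omult (a *s oone) (b *s oone) = (a * b) *s oone" for a b :: complex
    by (simp add: omult_scale)
  ultimately show ?thesis
    by (simp add: vec_eq_iff[where 'b=3] forall_3 omat_mult_def sum_3 omult_scale ocnj_omult
        omult_ocnj ocnj_add ocnj_scale power2_eq_square vector_sadd_rdistrib add_ac)
qed

text \<open>The quadratic adjoint of an element, the analogue of the adjugate of a 3 by 3
  matrix.\<close>

lemma jcross_hmat_self:
  "jcross (hmat a b c x y z) (hmat a b c x y z) =
     hmat (b * c - odot x x) (a * c - odot y y) (a * b - odot z z)
       (ocnj (omult y z) - a *s x) (ocnj (omult z x) - b *s y) (ocnj (omult x y) - c *s z)"
  unfolding jcross_def jmult_hmat_self jinner_hmat jone_def jtr_hmat cscale_hmat hmat_minus hmat_add hmat_eq_iff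
  by (simp add: vec_eq_iff field_simps power2_eq_square)

text \<open>Pairing an element with its adjoint meets the trilinear term once per octonion
  coordinate; cyclicity makes the three occurrences equal, which absorbs the factor 1/3.\<close>

lemma jdet_hmat:
  "jdet (hmat a b c x y z) =
     a * b * c + 2 * oform x y z - a * odot x x - b * odot y y - c * odot z z"
proof -
  have "odot x (ocnj (omult y z)) = oform x y z" "odot y (ocnj (omult z x)) = oform x y z"
     "odot z (ocnj (omult x y)) = oform x y z"
    by (metis oform_odot oform_cyclic odot_commute odot_ocnj ocnj_ocnj)+
  moreover have "odot x (y - k *s x) = odot x y - k * odot x x" for x y and k :: complex
    by (simp add: odot_def sum_subtractf sum_distrib_left algebra_simps)
  ultimately show ?thesis
    unfolding jdet_def jcross_hmat_self jinner_hmat by (simp add: right_diff_distrib)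
qed

lemma jherm_hmat:
  "jherm (hmat a b c x y z) (hmat a' b' c' x' y' z') =
     cnj a * a' + cnj b * b' + cnj c * c' +
     2 * (odot (ccnj x) x' + odot (ccnj y) y' + odot (ccnj z) z')"
  by (simp add: jherm_def tau_hmat jinner_hmat)

section \<open>Reflections and their determinant\<close>

definition reflect :: "real^'n \<Rightarrow> real^'n \<Rightarrow> real^'n" where
  "reflect v x = x - (2 * (v \<bullet> x) / (v \<bullet> v)) *\<^sub>R v"

lemma reflect_reflect:
  assumes "v \<noteq> 0" shows "reflect v (reflect v x) = x"
  using assms by (simp add: reflect_def inner_diff_right)

lemma linear_reflect: "linear (reflect v)"
  by (rule linearI) (simp_all add: reflect_def inner_add_right add_divide_distrib algebra_simps)

lemma inner_reflect: "reflect v x \<bullet> reflect v y = x \<bullet> y"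
  by (simp add: reflect_def inner_diff_left inner_diff_right inner_commute)

lemma inner_orthogonal_matrix:
  fixes A :: "real^'n^'n"
  assumes "orthogonal_matrix A"
  shows "(A *v x) \<bullet> (A *v y) = x \<bullet> y"
proof -
  have "orthogonal_transformation ((*v) A)"
    using assms by (simp add: orthogonal_transformation_matrix)
  then show ?thesis by (simp add: orthogonal_transformation_def)
qed

text \<open>An orthogonal \<open>Q\<close> carrying a basis vector to the unit normal conjugates the
  reflection to the diagonal matrix \<open>D\<close> with a single entry -1, so both have the same
  determinant.\<close>

lemma reflect_matrix:
  fixes v :: "real^'n"
  assumes "v \<noteq> 0"
  obtains R where "orthogonal_matrix R" "det R = -1" "\<And>x. R *v x = reflect v x"
proof -
  define R where "R = matrix (reflect v)"
  have Rx: "R *v x = reflect v x" for x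
    by (simp add: R_def linear_reflect)
  have "orthogonal_transformation (reflect v)"
    by (simp add: orthogonal_transformation_def linear_reflect inner_reflect)
  then have oR: "orthogonal_matrix R"
    by (simp add: R_def orthogonal_transformation_matrix)
  define k :: 'n where "k = undefined"
  define u where "u = (1 / norm v) *\<^sub>R v"
  have u: "norm u = 1" "v = norm v *\<^sub>R u" using assms by (simp_all add: u_def)
  obtain Q where Q: "orthogonal_matrix Q" "Q *v axis k 1 = u"
    by (rule orthogonal_matrix_exists_basis[OF u(1)])
  define D :: "real^'n^'n" where "D = (\<chi> i j. if i = j then (if i = k then -1 else 1) else 0)"
  have Dx: "D *v x = x - (2 * x$k) *s axis k 1" for x
    unfolding D_def matrix_vector_mult_def vec_eq_iff
    by (simp add: axis_def if_distrib[of "\<lambda>c. c * _"] cong: if_cong)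
  have "det D = (\<Prod>i\<in>UNIV. D$i$i)"
    by (rule det_diagonal) (simp add: D_def)
  also have "\<dots> = (\<Prod>i\<in>UNIV. if i = k then -1 else 1)"
    by (simp add: D_def)
  finally have dD: "det D = -1" by simp
  have "reflect v x = x - (2 * (u \<bullet> x)) *\<^sub>R u" for x
    using assms u(1) by (subst u(2), simp add: reflect_def norm_eq_1)
  moreover have "u \<bullet> (Q *v x) = x $ k" for x
  proof -
    have "(Q *v axis k 1) \<bullet> (Q *v x) = axis k 1 \<bullet> x"
      by (rule inner_orthogonal_matrix[OF Q(1)])
    then show ?thesis by (simp add: Q(2) inner_axis' )
  qed
  ultimately have "R *v (Q *v x) = Q *v (D *v x)" for x
    by (simp add: Rx Dx matrix_vector_mult_diff_distrib scalar_mult_eq_scaleR matrix_vector_mult_scaleR Q(2))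
  then have "R ** Q = Q ** D"
    by (simp add: matrix_eq flip: matrix_vector_mul_assoc)
  then have "det R * det Q = det Q * det D" by (metis det_mul)
  moreover have "det Q \<noteq> 0" using det_orthogonal_matrix[OF Q(1)] by auto
  ultimately have "det R = -1" by (metis dD mult.commute mult_left_cancel)
  then show thesis using that oR Rx by blast
qed

section \<open>Triality maps and the determinant of an orthogonal matrix\<close>

lemma odot_inner: "odot x y = x \<bullet> y"
  by (simp add: odot_def inner_vec_def)

text \<open>The polarisation of \<open>omult (ocnj w) (omult w y) = odot w w *s y\<close> at
  \<open>w = x + ocnj v\<close>: these are the mixed terms.\<close>

lemma oct_alternative:
  "omult v (omult x y) + omult (ocnj x) (omult (ocnj v) y) = (2 * odot v (ocnj x)) *s y"
  by (simp add: vec_eq_iff forall_8 oct_unfold odot_def sum_8 algebra_simps)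

lemma oct_left_inverse: "omult (ocnj v) (omult v y) = odot v v *s y" "omult v (omult (ocnj v) y) = odot v v *s y"
  and oct_right_inverse: "omult (omult y v) (ocnj v) = odot v v *s y"
  by (simp_all add: vec_eq_iff forall_8 oct_unfold odot_def sum_8 algebra_simps)

text \<open>The first components of autotopies of the octonion product. The companions
  \<open>g\<close> and \<open>h\<close> need only be bijections, which keeps closure under
  composition and inversion a matter of pure function algebra.\<close>

definition triality_maps :: "(real oct \<Rightarrow> real oct) set" where
  "triality_maps = {f. \<exists>g h. bij g \<and> bij h \<and> (\<forall>x y. omult (f x) (g y) = h (omult x y))}"

lemma triality_comp:
  assumes "f \<in> triality_maps" "f' \<in> triality_maps"
  shows "f \<circ> f' \<in> triality_maps"
proof -
  obtain g h where 1: "bij g" "bij h" "\<And>x y. omult (f x) (g y) = h (omult x y)"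
    using assms(1) by (auto simp: triality_maps_def)
  obtain g' h' where 2: "bij g'" "bij h'" "\<And>x y. omult (f' x) (g' y) = h' (omult x y)"
    using assms(2) by (auto simp: triality_maps_def)
  show ?thesis
    unfolding triality_maps_def
    by (rule CollectI, rule exI[of _ "g \<circ> g'"], rule exI[of _ "h \<circ> h'"])
      (simp add: 1 2 bij_comp)
qed

lemma triality_inverse:
  assumes "f \<in> triality_maps" "f \<circ> f' = id"
  shows "f' \<in> triality_maps"
proof -
  obtain g h where 1: "bij g" "bij h" "\<And>x y. omult (f x) (g y) = h (omult x y)"
    using assms(1) by (auto simp: triality_maps_def)
  have "omult (f' x) (inv_into UNIV g y) = inv_into UNIV h (omult x y)" for x y
  proof -
    have "h (omult (f' x) (inv_into UNIV g y)) = omult x y"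
      using assms(2) 1 by (metis bij_inv_eq_iff comp_apply id_apply)
    then show ?thesis using 1(2) by (metis bij_inv_eq_iff)
  qed
  then show ?thesis
    unfolding triality_maps_def using 1 bij_imp_bij_inv by blast
qed

lemma odot_pos: "v \<noteq> 0 \<Longrightarrow> odot v v \<noteq> (0::real)"
  by (simp add: odot_inner)

lemma bij_omult:
  fixes v :: "real oct"
  assumes "v \<noteq> 0" shows "bij (omult v)"
proof (rule o_bij)
  show "(\<lambda>y. (1 / odot v v) *s omult (ocnj v) y) \<circ> omult v = id"
    "omult v \<circ> (\<lambda>y. (1 / odot v v) *s omult (ocnj v) y) = id"
    using odot_pos[OF assms]
    by (simp_all add: fun_eq_iff oct_left_inverse omult_scale vector_smult_assoc)
qed

text \<open>By \<open>oct_alternative\<close>, the product of \<open>reflect v (ocnj x)\<close> with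
  \<open>- omult (ocnj v) y\<close> is \<open>omult v (omult x y)\<close>, so left multiplications
  serve as companions. The other order of composition reduces to this one with \<open>ocnj v\<close>
  in place of \<open>v\<close>.\<close>

lemma reflect_ocnj_triality:
  assumes "v \<noteq> 0"
  shows "reflect v \<circ> ocnj \<in> triality_maps" "ocnj \<circ> reflect v \<in> triality_maps"
proof -
  have 1: "reflect v \<circ> ocnj \<in> triality_maps" if "v \<noteq> 0" for v
  proof -
    have "ocnj v \<noteq> 0" using that by (metis ocnj_ocnj ocnj_zero)
    then have b: "bij (omult v)" "bij (\<lambda>y. - omult (ocnj v) y)"
      using bij_omult[OF that] bij_comp[OF bij_omult bij_uminus, of "ocnj v"] by (simp_all add: comp_def)
    have "omult (reflect v (ocnj x)) (- omult (ocnj v) y) = omult v (omult x y)" for x y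
    proof -
      have "omult (x - c *\<^sub>R z) w = omult x w - c *s omult z w" for x z w :: "real oct" and c
        by (metis add_diff_cancel diff_add_cancel omult_add(1) omult_scale(1) scalar_mult_eq_scaleR)
      then have "omult (reflect v (ocnj x)) (- omult (ocnj v) y) =
         (2 * odot v (ocnj x)) *s y - omult (ocnj x) (omult (ocnj v) y)"
        using odot_pos[OF that]
        by (simp add: reflect_def oct_left_inverse vector_smult_assoc odot_inner)
      then show ?thesis by (simp flip: oct_alternative)
    qed
    then show ?thesis
      unfolding triality_maps_def comp_def by (intro CollectI exI conjI allI) (rule b)+
  qed
  then show "reflect v \<circ> ocnj \<in> triality_maps" using assms .
  have "ocnj v \<noteq> 0" using assms by (metis ocnj_ocnj ocnj_zero)
  moreover have "ocnj \<circ> reflect v = reflect (ocnj v) \<circ> ocnj"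
  proof -
    have "ocnj x \<bullet> ocnj y = x \<bullet> y" for x y :: "real oct" by (metis odot_inner odot_ocnj)
    moreover have "ocnj (x - c *\<^sub>R z) = ocnj x - c *\<^sub>R ocnj z" for x z :: "real oct" and c
      by (simp add: vec_eq_iff)
    ultimately show ?thesis by (simp add: fun_eq_iff reflect_def)
  qed
  ultimately show "ocnj \<circ> reflect v \<in> triality_maps" using 1 by metis
qed

lemma ocnj_oone [simp]: "ocnj oone = oone"
  by (simp add: vec_eq_iff oone_def axis_def)

text \<open>Setting \<open>x\<close> and then \<open>y\<close> to the unit in the triality identity
  gives \<open>h = g\<close> and \<open>g x = omult (ocnj x) u\<close>, hence
  \<open>x(yu) = (yx)u\<close>. This forces \<open>u\<close> to be a nonzero real scalar and the
  octonions to be commutative.\<close>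

lemma ocnj_not_triality: "ocnj \<notin> triality_maps"
proof
  assume "ocnj \<in> triality_maps"
  then obtain g h :: "real oct \<Rightarrow> real oct" where g: "bij g" and gh: "\<And>x y. omult (ocnj x) (g y) = h (omult x y)"
    by (auto simp: triality_maps_def)
  have hg: "h x = g x" for x using gh[of oone x] by simp
  define u where "u = g oone"
  have gu: "g x = omult (ocnj x) u" for x using gh[of x oone] by (simp add: hg u_def)
  have u0: "u \<noteq> 0"
  proof
    assume "u = 0"
    then have "g x = 0" for x by (simp add: gu)
    then have "oone = (0::real oct)" using g by (metis bij_pointE)
    then show False by (metis oone_1 zero_index zero_neq_one)
  qed
  have eq: "omult x (omult y u) = omult (omult y x) u" for x y
    using gh[of "ocnj x" "ocnj y"] by (simp add: hg gu ocnj_omult)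
  \<comment> \<open>With \<open>y = ocnj u\<close> the left side of \<open>eq\<close> becomes
    \<open>odot u u *s x\<close>; multiplying by \<open>ocnj u\<close> on the right then shows that
    \<open>ocnj u\<close> is central for commutators.\<close>
  have cu: "omult x (ocnj u) = omult (ocnj u) x" for x
  proof -
    have "odot u u *s x = omult (omult (ocnj u) x) u"
      using eq[of x "ocnj u"] by (simp add: omult_ocnj omult_scale)
    then have "odot u u *s omult x (ocnj u) = odot u u *s omult (ocnj u) x"
      by (metis oct_right_inverse omult_scale(1))
    then show ?thesis using odot_pos[OF u0] by (simp add: vector_mul_lcancel)
  qed
  \<comment> \<open>Commuting with these four imaginary units already kills all imaginary
    coordinates.\<close>
  have "ocnj u = (ocnj u $ 1) *s oone"
    using cu[of "axis 2 1"] cu[of "axis 3 1"] cu[of "axis 5 1"] cu[of "axis 6 1"]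
    by (simp add: vec_eq_iff forall_8 oct_unfold oone_def axis_def)
  then have "ocnj (ocnj u) = (ocnj u $ 1) *s oone"
    by (metis ocnj_scale ocnj_omult omult_oone(1) ocnj_ocnj)
  then obtain r where r: "u = r *s oone" by simp
  with u0 have "r \<noteq> 0" by auto
  then have "omult x y = omult y x" for x y :: "real oct"
    using eq[of x y] by (simp add: r omult_scale vector_mul_lcancel)
  from this[of "axis 2 1" "axis 3 1"] show False
    by (simp add: vec_eq_iff forall_8 oct_unfold axis_def)
qed

text \<open>An orthogonal map is a product of reflections (each one fixes one more basis vector), and a
  reflection composed with the octonion conjugation is a triality map, whereas the conjugation
  itself is not.\<close>

lemma orthogonal_triality:
  fixes A :: "real^8^8"
  assumes "orthogonal_matrix A"
  shows "det A = 1 \<and> (*v) A \<in> triality_maps \<or> det A = -1 \<and> ocnj \<circ> (*v) A \<in> triality_maps"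
  using assms
proof (induction "card {i. A *v axis i 1 \<noteq> axis i 1}" arbitrary: A rule: less_induct)
  case less
  show ?case
  proof (cases "\<exists>i. A *v axis i 1 \<noteq> axis i 1")
    case False
    have "A = mat 1"
    proof -
      have "A $ i $ j = (mat 1 :: real^8^8) $ i $ j" for i j
      proof -
        have "A *v axis j 1 = axis j 1" using False by blast
        then have "(A *v axis j 1) $ i = axis j 1 $ i" by simp
        then show ?thesis by (simp add: matrix_vector_mul_component axis_def inner_vec_def mat_def if_distrib cong: if_cong)
      qed
      then show ?thesis by (simp add: vec_eq_iff)
    qed
    moreover have "(*v) (mat 1 :: real^8^8) \<in> triality_maps"
      unfolding triality_maps_def by (rule CollectI, rule exI[of _ id], rule exI[of _ id]) simp
    ultimately show ?thesis by (simp)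
  next
    case True
    then obtain i where i: "A *v axis i 1 \<noteq> axis i 1" by blast
    \<comment> \<open>The reflection in the difference of two vectors of equal length exchanges
      them. Basis vectors already fixed by \<open>A\<close> are orthogonal to \<open>v\<close>, so
      they stay fixed.\<close>
    define v where "v = A *v axis i 1 - axis i 1"
    have v0: "v \<noteq> 0" using i by (simp add: v_def)
    obtain R where R: "orthogonal_matrix R" "det R = -1" "\<And>x. R *v x = reflect v x"
      using reflect_matrix[OF v0] by blast
    note oA = inner_orthogonal_matrix[OF less.prems]
    have oRA: "orthogonal_matrix (R ** A)" by (rule orthogonal_matrix_mul[OF R(1) less.prems])
    have "{j. (R ** A) *v axis j 1 \<noteq> axis j 1} \<subset> {j. A *v axis j 1 \<noteq> axis j 1}"
    proof
      have "v \<bullet> axis j 1 = 0" if j: "A *v axis j 1 = axis j 1" for j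
      proof -
        have "j \<noteq> i" using i j by auto
        then have "axis i 1 \<bullet> (axis j 1 :: real^8) = 0" by (simp add: inner_axis_axis)
        then show ?thesis using oA[of "axis i 1" "axis j 1"] by (simp add: v_def j inner_diff_left)
      qed
      then show "{j. (R ** A) *v axis j 1 \<noteq> axis j 1} \<subseteq> {j. A *v axis j 1 \<noteq> axis j 1}"
        by (auto simp: R(3) reflect_def simp flip: matrix_vector_mul_assoc)
      have "2 * (v \<bullet> (A *v axis i 1)) = v \<bullet> v"
        using oA[of "axis i 1" "axis i 1"] by (simp add: v_def inner_diff_left inner_diff_right inner_commute)
      then have "reflect v (A *v axis i 1) = axis i 1"
        using v0 by (simp add: reflect_def) (simp add: v_def)
      then have "(R ** A) *v axis i 1 = axis i 1"
        by (simp add: R(3) flip: matrix_vector_mul_assoc)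
      then show "{j. (R ** A) *v axis j 1 \<noteq> axis j 1} \<noteq> {j. A *v axis j 1 \<noteq> axis j 1}"
        using i by blast
    qed
    then have "card {j. (R ** A) *v axis j 1 \<noteq> axis j 1} < card {j. A *v axis j 1 \<noteq> axis j 1}"
      by (intro psubset_card_mono) auto
    note IH = less.hyps[OF this oRA]
    have RA: "(*v) (R ** A) = reflect v \<circ> (*v) A"
      by (simp add: fun_eq_iff R(3) flip: matrix_vector_mul_assoc)
    have dA: "det (R ** A) = - det A" by (simp add: det_mul R(2))
    \<comment> \<open>One more reflection changes the sign of the determinant and also swaps the two
      alternatives: \<open>ocnj\<close> is inserted in the first equation and cancelled in the
      second.\<close>
    have e: "(ocnj \<circ> reflect v) \<circ> (reflect v \<circ> (*v) A) = ocnj \<circ> (*v) A"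
      "(reflect v \<circ> ocnj) \<circ> (ocnj \<circ> (reflect v \<circ> (*v) A)) = (*v) A"
      by (simp_all add: fun_eq_iff reflect_reflect[OF v0])
    show ?thesis
      using IH triality_comp reflect_ocnj_triality[OF v0] e unfolding RA dA
      by (metis add.inverse_inverse)
  qed
qed

text \<open>Otherwise both \<open>A\<close> and its composition with \<open>ocnj\<close> would be
  triality maps; cancelling \<open>A\<close> would leave \<open>ocnj\<close> itself.\<close>

lemma det_triality_map:
  fixes A :: "real^8^8"
  assumes A: "orthogonal_matrix A" and T: "(*v) A \<in> triality_maps"
  shows "det A = 1"
proof (rule ccontr)
  assume "det A \<noteq> 1"
  then have K: "ocnj \<circ> (*v) A \<in> triality_maps" using orthogonal_triality[OF A] by blast
  have id: "(*v) A \<circ> (*v) (transpose A) = id"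
    using A by (simp add: fun_eq_iff orthogonal_matrix_def matrix_vector_mul_assoc
        del: transpose_matrix_vector)
  have "(ocnj \<circ> (*v) A) \<circ> (*v) (transpose A) \<in> triality_maps"
    using K triality_inverse[OF T id] by (rule triality_comp)
  then show False using ocnj_not_triality by (simp add: comp_assoc id)
qed

section \<open>Block maps and complex multiples of real matrices\<close>

text \<open>The shape of every linear map that acts on each of the six coordinates separately. The
  matrices are complex because unit scalars may twist the real triality components.\<close>

definition jblock :: "complex \<Rightarrow> complex \<Rightarrow> complex \<Rightarrow> complex^8^8 \<Rightarrow> complex^8^8 \<Rightarrow> complex^8^8 \<Rightarrow>
    complex omat \<Rightarrow> complex omat" where
  "jblock d1 d2 d3 M1 M2 M3 = (\<lambda>X\<in>JC. hmat (d1 * X$1$1$1) (d2 * X$2$2$1) (d3 * X$3$3$1)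
     (M1 *v (X$2$3)) (M2 *v (X$3$1)) (M3 *v (X$1$2)))"

lemma jblock_hmat:
  "jblock d1 d2 d3 M1 M2 M3 (hmat a b c x y z) =
     hmat (d1 * a) (d2 * b) (d3 * c) (M1 *v x) (M2 *v y) (M3 *v z)"
  by (simp add: jblock_def hmat_in_JC)

lemma jblock_extensional: "jblock d1 d2 d3 M1 M2 M3 \<in> extensional JC"
  by (simp add: jblock_def)

lemma jblock_in_JC: "X \<in> JC \<Longrightarrow> jblock d1 d2 d3 M1 M2 M3 X \<in> JC"
  by (simp add: jblock_def hmat_in_JC)

lemma extensional_JC_eqI:
  assumes "\<alpha> \<in> extensional JC" "\<beta> \<in> extensional JC"
    and "\<And>a b c x y z. \<alpha> (hmat a b c x y z) = \<beta> (hmat a b c x y z)"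
  shows "\<alpha> = \<beta>"
  using assms by (metis extensionalityI JC_cases)

lemma jblock_compose:
  "compose JC (jblock d1 d2 d3 M1 M2 M3) (jblock e1 e2 e3 N1 N2 N3) =
     jblock (d1 * e1) (d2 * e2) (d3 * e3) (M1 ** N1) (M2 ** N2) (M3 ** N3)"
  by (rule extensional_JC_eqI)
    (simp_all add: jblock_extensional compose_extensional compose_eq hmat_in_JC jblock_hmat
      matrix_vector_mul_assoc mult.assoc)

lemma jblock_one: "jblock 1 1 1 (mat 1) (mat 1) (mat 1) = (\<lambda>X\<in>JC. X)"
  by (rule extensional_JC_eqI) (simp_all add: jblock_extensional hmat_in_JC jblock_hmat)

lemma jblock_eq_iff:
  "jblock d1 d2 d3 M1 M2 M3 = jblock e1 e2 e3 N1 N2 N3 \<longleftrightarrow>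
     d1 = e1 \<and> d2 = e2 \<and> d3 = e3 \<and> M1 = N1 \<and> M2 = N2 \<and> M3 = N3"
proof
  assume eq: "jblock d1 d2 d3 M1 M2 M3 = jblock e1 e2 e3 N1 N2 N3"
  have "hmat d1 d2 d3 (M1 *v x) (M2 *v x) (M3 *v x) = hmat e1 e2 e3 (N1 *v x) (N2 *v x) (N3 *v x)" for x
    using fun_cong[OF eq, of "hmat 1 1 1 x x x"] by (simp add: jblock_hmat)
  then show "d1 = e1 \<and> d2 = e2 \<and> d3 = e3 \<and> M1 = N1 \<and> M2 = N2 \<and> M3 = N3"
    unfolding hmat_eq_iff by (simp add: matrix_eq)
qed simp

definition cmat :: "complex \<Rightarrow> real^8^8 \<Rightarrow> complex^8^8" where
  "cmat c A = (\<chi> i j. c * complex_of_real (A$i$j))"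

lemma cmat_mult: "cmat c A ** cmat d B = cmat (c * d) (A ** B)"
  by (simp add: cmat_def matrix_matrix_mult_def vec_eq_iff sum_distrib_left ac_simps)

lemma cmat_one: "cmat 1 (mat 1) = mat 1"
  by (simp add: cmat_def mat_def vec_eq_iff)

lemma cmat_scale: "cmat (c * d) A *v x = c *s (cmat d A *v x)"
  by (simp add: cmat_def matrix_vector_mult_def vec_eq_iff sum_distrib_left ac_simps)

lemma cmat_apply: "cmat c A *v x = c *s (cmat 1 A *v x)"
  using cmat_scale[of c 1] by simp

lemma ccnj_scale: "ccnj (c *s x) = cnj c *s ccnj x"
  by (simp add: ccnj_def vec_eq_iff)

lemma ccnj_cmat: "ccnj (cmat c A *v x) = cmat (cnj c) A *v ccnj x"
  by (simp add: ccnj_def cmat_def matrix_vector_mult_def vec_eq_iff)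

lemma odot_matrix: "odot (M *v x) y = odot x (transpose M *v y)"
  unfolding odot_def matrix_vector_mult_def transpose_def
  by (simp add: sum_distrib_left sum_distrib_right ac_simps, rule sum.swap)

text \<open>Two different scalars are allowed because the Hermitian form pairs
  \<open>cmat (cnj c) A\<close> with \<open>cmat c A\<close>.\<close>

lemma odot_cmat:
  assumes "orthogonal_matrix A"
  shows "odot (cmat c A *v x) (cmat d A *v y) = c * d * odot x y"
proof -
  have "transpose (cmat 1 A) = cmat 1 (transpose A)"
    by (simp add: cmat_def transpose_def)
  then have "odot (cmat 1 A *v x) (cmat 1 A *v y) = odot x y"
    using assms by (simp add: odot_matrix matrix_vector_mul_assoc cmat_mult cmat_one
        orthogonal_matrix_def del: transpose_matrix_vector)
  then show ?thesis
    by (simp add: cmat_apply[of c] cmat_apply[of d] odot_scale)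
qed

definition cvec :: "real oct \<Rightarrow> complex oct" where
  "cvec x = (\<chi> i. complex_of_real (x$i))"

lemma cvec_simps:
  "omult (cvec x) (cvec y) = cvec (omult x y)" "ocnj (cvec x) = cvec (ocnj x)"
  "cmat 1 A *v cvec x = cvec (A *v x)" "odot (cvec x) (cvec y) = complex_of_real (odot x y)"
  by (simp_all add: cvec_def cmat_def vec_eq_iff forall_8 oct_unfold matrix_vector_mult_def odot_def)

lemma cvec_decompose:
  obtains u v where "x = cvec u + \<i> *s cvec v"
proof
  show "x = cvec (\<chi> i. Re (x$i)) + \<i> *s cvec (\<chi> i. Im (x$i))"
    by (simp add: vec_eq_iff cvec_def complex_eq_iff)
qed

lemma Spin8_iff:
  "(A1, A2, A3) \<in> carrier Spin8 \<longleftrightarrow>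
     orthogonal_matrix A1 \<and> det A1 = 1 \<and> orthogonal_matrix A2 \<and> det A2 = 1 \<and>
     orthogonal_matrix A3 \<and> det A3 = 1 \<and>
     (\<forall>x y. omult (A1 *v x) (A2 *v y) = ocnj (A3 *v ocnj (omult x y)))"
  by (auto simp: Spin8_def SO8_def rotation_matrix_def)

lemma ocnj_diff: "ocnj (x - y) = ocnj x - ocnj y"
  by (simp add: vec_eq_iff)

text \<open>Both sides are complex bilinear and agree on complexified real octonions, which span
  everything over the complex numbers.\<close>

lemma Spin8_complex_triality:
  assumes "(A1, A2, A3) \<in> carrier Spin8"
  shows "omult (cmat 1 A1 *v x) (cmat 1 A2 *v y) = ocnj (cmat 1 A3 *v ocnj (omult x y))"
proof -
  have t: "omult (cmat 1 A1 *v cvec x) (cmat 1 A2 *v cvec y) = ocnj (cmat 1 A3 *v ocnj (omult (cvec x) (cvec y)))" for x y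
    using assms by (simp add: cvec_simps Spin8_iff)
  obtain u v where x: "x = cvec u + \<i> *s cvec v" by (rule cvec_decompose)
  obtain u' v' where y: "y = cvec u' + \<i> *s cvec v'" by (rule cvec_decompose)
  show ?thesis
    unfolding x y
    by (simp add: omult_add omult_scale matrix_vector_right_distrib vector_scalar_commute
        matrix_vector_mult_diff_distrib ocnj_add ocnj_diff ocnj_scale t)
qed

lemma oform_scale: "oform (a *s x) (b *s y) (c *s z) = a * b * c * oform x y z"
  by (simp add: oform_def omult_scale)

text \<open>Triality turns the product of the first two arguments into \<open>A3\<close> applied to
  \<open>ocnj (omult x y)\<close>, up to conjugation, and orthogonality of \<open>A3\<close> removes
  it from the pairing with the third.\<close>

lemma oform_cmat:
  assumes "(A1, A2, A3) \<in> carrier Spin8"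
  shows "oform (cmat a A1 *v x) (cmat b A2 *v y) (cmat c A3 *v z) = a * b * c * oform x y z"
proof -
  have "oform (cmat 1 A1 *v x) (cmat 1 A2 *v y) (cmat 1 A3 *v z) = oform x y z"
    using assms unfolding oform_odot Spin8_complex_triality[OF assms] odot_ocnj
    by (simp add: odot_cmat Spin8_iff) (metis odot_ocnj ocnj_ocnj)
  then show ?thesis
    by (simp add: cmat_apply[of a] cmat_apply[of b] cmat_apply[of c] oform_scale)
qed

text \<open>The five terms of the determinant pick up exactly the five scalar products assumed to be
  1.\<close>

lemma jdet_jblock_cmat:
  assumes S: "(A1, A2, A3) \<in> carrier Spin8"
    and d: "d1 * d2 * d3 = 1" and c: "c1 * c2 * c3 = 1"
    and "d1 * (c1 * c1) = 1" "d2 * (c2 * c2) = 1" "d3 * (c3 * c3) = 1"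
  shows "jdet (jblock d1 d2 d3 (cmat c1 A1) (cmat c2 A2) (cmat c3 A3) (hmat a b c x y z)) =
    jdet (hmat a b c x y z)"
proof -
  have O: "orthogonal_matrix A1" "orthogonal_matrix A2" "orthogonal_matrix A3"
    using S by (simp_all add: Spin8_iff)
  have "d1 * a * (d2 * b) * (d3 * c) = (d1 * d2 * d3) * (a * b * c)"
    "d1 * a * (c1 * c1 * odot x x) = (d1 * (c1 * c1)) * (a * odot x x)"
    "d2 * b * (c2 * c2 * odot y y) = (d2 * (c2 * c2)) * (b * odot y y)"
    "d3 * c * (c3 * c3 * odot z z) = (d3 * (c3 * c3)) * (c * odot z z)"
    by (simp_all only: ac_simps)
  then show ?thesis
    unfolding jblock_hmat jdet_hmat oform_cmat[OF S] odot_cmat[OF O(1)] odot_cmat[OF O(2)]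
      odot_cmat[OF O(3)] by (simp only: assms(2-) mult_1_left)
qed

lemma jherm_jblock_cmat:
  assumes O: "orthogonal_matrix A1" "orthogonal_matrix A2" "orthogonal_matrix A3"
    and "cnj d1 * d1 = 1" "cnj d2 * d2 = 1" "cnj d3 * d3 = 1"
    and "cnj c1 * c1 = 1" "cnj c2 * c2 = 1" "cnj c3 * c3 = 1"
  shows "jherm (jblock d1 d2 d3 (cmat c1 A1) (cmat c2 A2) (cmat c3 A3) (hmat a b c x y z))
    (jblock d1 d2 d3 (cmat c1 A1) (cmat c2 A2) (cmat c3 A3) (hmat a' b' c' x' y' z')) =
    jherm (hmat a b c x y z) (hmat a' b' c' x' y' z')"
proof -
  have "cnj (d * a) * (d * a') = (cnj d * d) * (cnj a * a')" for a a' d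
    by simp
  then show ?thesis
    unfolding jblock_hmat jherm_hmat ccnj_cmat odot_cmat[OF O(1)] odot_cmat[OF O(2)] odot_cmat[OF O(3)]
    by (simp only: assms(4-) mult_1_left)
qed

section \<open>The homomorphism \<open>phi\<close> into the fixed subgroup of
  \<open>E6\<close>\<close>

text \<open>
  The scalars on the diagonal have product 1, so have those on the off-diagonal entries, and the
  \<open>k\<close>-th off-diagonal scalar is a square root of the inverse of the \<open>k\<close>-th diagonal one: these are
  the conditions for the determinant to be preserved. On \<^const>\<open>U1\<close> the inverse is \<^const>\<open>cnj\<close>.
\<close>

definition phi :: "complex \<times> complex \<times> (real^8^8) \<times> (real^8^8) \<times> (real^8^8) \<Rightarrow>
    complex omat \<Rightarrow> complex omat" where
  "phi = (\<lambda>(t, n, A1, A2, A3). jblock (t^4) ((cnj t)^2 * n^2) ((cnj t)^2 * (cnj n)^2)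
     (cmat ((cnj t)^2) A1) (cmat (t * cnj n) A2) (cmat (t * n) A3))"

lemma UUSpin_iff:
  "(t, n, A1, A2, A3) \<in> carrier UUSpin \<longleftrightarrow> cnj t * t = 1 \<and> cnj n * n = 1 \<and> (A1, A2, A3) \<in> carrier Spin8"
  by (simp add: UUSpin_def U1_def)

lemma phi_mult: "phi (g \<otimes>\<^bsub>UUSpin\<^esub> h) = compose JC (phi g) (phi h)"
proof -
  obtain t n A1 A2 A3 where g: "g = (t, n, A1, A2, A3)" by (metis prod.exhaust)
  obtain s m B1 B2 B3 where h: "h = (s, m, B1, B2, B3)" by (metis prod.exhaust)
  show ?thesis
    unfolding g h UUSpin_simps phi_def prod.case jblock_compose jblock_eq_iff cmat_mult
    by (simp add: power_mult_distrib ac_simps)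
qed

lemma phi_one: "phi \<one>\<^bsub>UUSpin\<^esub> = (\<lambda>X\<in>JC. X)"
  by (simp add: phi_def UUSpin_simps cmat_one jblock_one)

lemma phi_in_JC: "X \<in> JC \<Longrightarrow> phi g X \<in> JC"
  by (cases g) (simp add: phi_def jblock_in_JC)

text \<open>Multiplicativity makes \<open>phi\<close> of the inverse element a two-sided inverse
  map, which gives bijectivity. Invariance of both forms then reduces to identities between scalars
  of modulus 1.\<close>

lemma phi_in_E6:
  assumes g: "g \<in> carrier UUSpin"
  shows "phi g \<in> carrier E6"
proof (rule E6_memI)
  interpret G: group UUSpin by (rule group_UUSpin)
  define h where "h = inv\<^bsub>UUSpin\<^esub> g"
  have "compose JC (phi g) (phi h) = (\<lambda>X\<in>JC. X)" "compose JC (phi h) (phi g) = (\<lambda>X\<in>JC. X)"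
    using g by (simp_all add: h_def G.l_inv G.r_inv phi_one flip: phi_mult)
  then have inv: "phi g (phi h X) = X" "phi h (phi g X) = X" if "X \<in> JC" for X
    using that by (metis compose_eq restrict_apply')+
  have "bij_betw (phi g) JC JC"
    by (rule bij_betw_byWitness[where f' = "phi h"]) (auto simp: inv phi_in_JC)
  moreover have "phi g \<in> extensional JC"
    by (cases g) (simp add: phi_def jblock_extensional)
  ultimately show "phi g \<in> Bij JC" by (simp add: Bij_def)
  obtain t n A1 A2 A3 where gt: "g = (t, n, A1, A2, A3)" by (metis prod.exhaust)
  have t: "cnj t * t = 1" and n: "cnj n * n = 1" and S: "(A1, A2, A3) \<in> carrier Spin8"
    using g by (simp_all add: gt UUSpin_iff)
  have O: "orthogonal_matrix A1" "orthogonal_matrix A2" "orthogonal_matrix A3"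
    using S by (simp_all add: Spin8_iff)
  have U: "(cnj t)^k * t^k = 1" "(cnj n)^k * n^k = 1" for k
    using t n by (simp_all flip: power_mult_distrib)
  \<comment> \<open>Each product is regrouped into factors \<open>(cnj t)^k * t^k\<close> and
    \<open>(cnj n)^k * n^k\<close> that \<open>U\<close> rewrites to 1; the exponent 1 is written
    out so that \<open>U\<close> matches.\<close>
  have "t^4 * ((cnj t)^2 * n^2) * ((cnj t)^2 * (cnj n)^2) = ((cnj t)^4 * t^4) * ((cnj n)^2 * n^2)"
    "(cnj t)^2 * (t * cnj n) * (t * n) = ((cnj t)^2 * t^2) * ((cnj n)^1 * n^1)"
    "t^4 * ((cnj t)^2 * (cnj t)^2) = (cnj t)^4 * t^4"
    "(cnj t)^2 * n^2 * ((t * cnj n) * (t * cnj n)) = ((cnj t)^2 * t^2) * ((cnj n)^2 * n^2)"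
    "(cnj t)^2 * (cnj n)^2 * ((t * n) * (t * n)) = ((cnj t)^2 * t^2) * ((cnj n)^2 * n^2)"
    by (simp_all add: power2_eq_square power4_eq_xxxx)
  note dets = this[unfolded U mult_1_left]
  have "cnj (t^4) * t^4 = (cnj t)^4 * t^4"
    "cnj ((cnj t)^2 * n^2) * ((cnj t)^2 * n^2) = ((cnj t)^2 * t^2) * ((cnj n)^2 * n^2)"
    "cnj ((cnj t)^2 * (cnj n)^2) * ((cnj t)^2 * (cnj n)^2) = ((cnj t)^2 * t^2) * ((cnj n)^2 * n^2)"
    "cnj ((cnj t)^2) * (cnj t)^2 = (cnj t)^2 * t^2"
    "cnj (t * cnj n) * (t * cnj n) = ((cnj t)^1 * t^1) * ((cnj n)^1 * n^1)"
    "cnj (t * n) * (t * n) = ((cnj t)^1 * t^1) * ((cnj n)^1 * n^1)"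
    by (simp_all add: ac_simps)
  note herms = this[unfolded U mult_1_left]
  show "phi g (X + Y) = phi g X + phi g Y" if "X \<in> JC" "Y \<in> JC" for X Y
    using that by (elim JC_cases)
      (simp add: gt phi_def hmat_add jblock_hmat matrix_vector_right_distrib distrib_left)
  show "phi g (cscale c X) = cscale c (phi g X)" if "X \<in> JC" for c X
    using that by (elim JC_cases)
      (simp add: gt phi_def cscale_hmat jblock_hmat vector_scalar_commute ac_simps)
  show "jdet (phi g X) = jdet X" if "X \<in> JC" for X
    using that by (elim JC_cases) (simp only: gt phi_def prod.case jdet_jblock_cmat[OF S dets])
  show "jherm (phi g X) (phi g Y) = jherm X Y" if "X \<in> JC" "Y \<in> JC" for X Y
    using that by (elim JC_cases) (simp only: gt phi_def prod.case jherm_jblock_cmat[OF O herms])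
qed

lemma jsigma_hmat: "jsigma (hmat a b c x y z) = hmat a b c x (- y) (- z)"
  "jsigma' (hmat a b c x y z) = hmat a b c (- x) (- y) z"
  by (simp_all add: jsigma_def jsigma'_def hmat_in_JC)

lemma E6_mult: "\<alpha> \<in> carrier E6 \<Longrightarrow> \<beta> \<in> carrier E6 \<Longrightarrow> \<alpha> \<otimes>\<^bsub>E6\<^esub> \<beta> = compose JC \<alpha> \<beta>"
  by (simp add: E6_def BijGroup_def)

text \<open>Replaces the group equation by a pointwise one; nothing is lost since both sides are
  extensional on \<open>JC\<close>.\<close>

lemma E6_fix_iff:
  assumes s: "s \<in> carrier E6" and a: "\<alpha> \<in> carrier E6"
  shows "\<alpha> \<in> E6_fix s \<longleftrightarrow> (\<forall>X\<in>JC. s (\<alpha> (s X)) = \<alpha> X)"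
proof -
  interpret E: group E6 by (rule group_E6)
  have e: "\<alpha> \<in> extensional JC" using E6_memD(1)[OF a] by (simp add: Bij_def)
  have "s \<otimes>\<^bsub>E6\<^esub> \<alpha> \<otimes>\<^bsub>E6\<^esub> s = compose JC (compose JC s \<alpha>) s"
    using s a E.m_closed[OF s a] by (simp add: E6_mult)
  moreover have "compose JC (compose JC s \<alpha>) s = \<alpha> \<longleftrightarrow> (\<forall>X\<in>JC. s (\<alpha> (s X)) = \<alpha> X)"
  proof
    assume "compose JC (compose JC s \<alpha>) s = \<alpha>"
    then show "\<forall>X\<in>JC. s (\<alpha> (s X)) = \<alpha> X" by (metis compose_eq E6_memD(2)[OF s])
  next
    assume "\<forall>X\<in>JC. s (\<alpha> (s X)) = \<alpha> X"
    then show "compose JC (compose JC s \<alpha>) s = \<alpha>"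
      by (intro extensionalityI[OF compose_extensional e]) (simp add: compose_eq E6_memD(2)[OF s])
  qed
  ultimately show ?thesis by (simp add: E6_fix_def a)
qed

lemma phi_fixed:
  assumes "g \<in> carrier UUSpin"
  shows "phi g \<in> E6_fix jsigma \<inter> E6_fix jsigma'"
proof -
  have m: "M *v (- x) = - (M *v x)" for M :: "complex^8^8" and x
    by (simp add: matrix_vector_mult_def vec_eq_iff sum_negf)
  have "jsigma (phi g (jsigma X)) = phi g X" "jsigma' (phi g (jsigma' X)) = phi g X" if "X \<in> JC" for X
    using that by (cases g, elim JC_cases, simp add: phi_def jblock_hmat jsigma_hmat m)+
  then show ?thesis
    using phi_in_E6[OF assms] by (simp add: E6_fix_iff jsigma_in_E6)
qed

section \<open>Surjectivity: from a fixed element to its triality triple\<close>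

lemma cmat_nth: "cmat c A $ i $ j = c * complex_of_real (A$i$j)"
  by (simp add: cmat_def)

lemma cmat_eq_iff: "c \<noteq> 0 \<Longrightarrow> cmat c A = cmat c B \<longleftrightarrow> A = B"
  by (simp add: vec_eq_iff cmat_nth)

text \<open>A map preserving both the bilinear and the Hermitian form commutes with complex
  conjugation, so its entries are real.\<close>

lemma real_matrixE:
  fixes M :: "complex^8^8"
  assumes q: "\<And>x y. odot (M *v x) (M *v y) = odot x y"
    and h: "\<And>x y. odot (ccnj (M *v x)) (M *v y) = odot (ccnj x) y"
  obtains A where "orthogonal_matrix A" "M = cmat 1 A"
proof -
  have "transpose M *v (M *v y) = y" for y
    by (rule odot_ext) (metis odot_commute odot_matrix q)
  then have tM: "transpose M ** M = mat 1"
    by (simp add: matrix_eq matrix_vector_mul_assoc del: transpose_matrix_vector)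
  then have Mt: "M ** transpose M = mat 1" by (metis matrix_left_right_inverse)
  \<comment> \<open>Every \<open>z\<close> equals \<open>M *v w\<close> for some \<open>w\<close>,
    and pairing either side with it gives \<open>odot (ccnj x) w\<close>: by \<open>h\<close> on the
    left, by \<open>q\<close> on the right.\<close>
  have c: "ccnj (M *v x) = M *v ccnj x" for x
  proof (rule odot_ext)
    fix z
    have "z = M *v (transpose M *v z)"
      by (simp add: matrix_vector_mul_assoc Mt del: transpose_matrix_vector)
    then show "odot (ccnj (M *v x)) z = odot (M *v ccnj x) z" by (metis h q)
  qed
  have re: "cnj (M$i$j) = M$i$j" for i j
  proof -
    have "ccnj (axis j 1) = axis j 1" by (simp add: ccnj_def axis_def vec_eq_iff)
    with c[of "axis j 1"] have "ccnj (M *v axis j 1) $ i = (M *v axis j 1) $ i" by simp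
    moreover have "(M *v axis j 1) $ i = M$i$j"
      by (simp add: matrix_vector_mult_def axis_def if_distrib cong: if_cong)
    ultimately show ?thesis by (simp add: ccnj_def)
  qed
  define A where "A = (\<chi> i j. Re (M$i$j))"
  have M: "M = cmat 1 A"
    using re by (simp add: vec_eq_iff cmat_nth A_def complex_eq_iff)
  have "transpose M = cmat 1 (transpose A)" by (simp add: M cmat_def transpose_def)
  then have "cmat 1 (transpose A ** A) = cmat 1 (mat 1)"
    using tM by (simp add: M cmat_mult cmat_one)
  then have "orthogonal_matrix A" by (simp add: cmat_eq_iff orthogonal_matrix)
  then show thesis using M that by blast
qed

text \<open>Scaling \<open>M\<close> by the square root \<open>k\<close> of \<open>d\<close> removes
  the factor from the bilinear form, and \<open>k\<close> being a unit leaves the Hermitian form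
  intact.\<close>

lemma unit_multiple_of_real_matrixE:
  fixes M :: "complex^8^8"
  assumes k: "cnj k * k = 1" "k^2 = d"
    and q: "\<And>x y. d * odot (M *v x) (M *v y) = odot x y"
    and h: "\<And>x y. odot (ccnj (M *v x)) (M *v y) = odot (ccnj x) y"
  obtains A where "orthogonal_matrix A" "M = cmat (cnj k) A"
proof -
  define N where "N = (\<chi> i j. k * M$i$j)"
  have N: "N *v x = k *s (M *v x)" for x
    by (simp add: N_def matrix_vector_mult_def vec_eq_iff sum_distrib_left ac_simps)
  have "odot (N *v x) (N *v y) = odot x y" for x y
    using q[of x y] by (simp add: N odot_scale power2_eq_square ac_simps flip: k(2))
  moreover have "odot (ccnj (N *v x)) (N *v y) = odot (ccnj x) y" for x y
    using k(1) by (simp add: N odot_scale ccnj_scale h mult.commute[of k] flip: mult.assoc)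
  ultimately obtain A where A: "orthogonal_matrix A" "N = cmat 1 A"
    by (rule real_matrixE)
  have "M$i$j = cnj k * (N$i$j)" for i j
    using k(1) by (simp add: N_def flip: mult.assoc)
  then have "M = cmat (cnj k) A" by (simp add: A(2) vec_eq_iff cmat_nth)
  with A(1) show thesis by (rule that)
qed

lemma oform_zero [simp]: "oform 0 y z = 0" "oform x 0 z = 0" "oform x y 0 = 0"
  by (simp_all add: oform_def)

lemma ccnj_zero [simp]: "ccnj 0 = 0"
  by (simp add: ccnj_def vec_eq_iff)

text \<open>Each conclusion isolates one term of the determinant or of the Hermitian form by setting
  the other coordinates to zero.\<close>

lemma jblock_E6D:
  assumes J: "jblock d1 d2 d3 M1 M2 M3 \<in> carrier E6"
  shows "d1 * d2 * d3 = 1"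
    and "cnj d1 * d1 = 1" "cnj d2 * d2 = 1" "cnj d3 * d3 = 1"
    and "d1 * odot (M1 *v x) (M1 *v y) = odot x y" "d2 * odot (M2 *v x) (M2 *v y) = odot x y"
      "d3 * odot (M3 *v x) (M3 *v y) = odot x y"
    and "odot (ccnj (M1 *v x)) (M1 *v y) = odot (ccnj x) y"
      "odot (ccnj (M2 *v x)) (M2 *v y) = odot (ccnj x) y"
      "odot (ccnj (M3 *v x)) (M3 *v y) = odot (ccnj x) y"
    and "oform (M1 *v x) (M2 *v y) (M3 *v z) = oform x y z"
proof -
  have d: "jdet (hmat (d1 * a) (d2 * b) (d3 * c) (M1 *v x) (M2 *v y) (M3 *v z)) = jdet (hmat a b c x y z)"
    for a b c x y z
    using E6_memD(5)[OF J hmat_in_JC] by (simp add: jblock_hmat)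
  have h: "jherm (hmat (d1 * a) (d2 * b) (d3 * c) (M1 *v x) (M2 *v y) (M3 *v z))
      (hmat (d1 * a') (d2 * b') (d3 * c') (M1 *v x') (M2 *v y') (M3 *v z')) =
      jherm (hmat a b c x y z) (hmat a' b' c' x' y' z')" for a b c x y z a' b' c' x' y' z'
    using E6_memD(6)[OF J hmat_in_JC hmat_in_JC] by (simp add: jblock_hmat)
  show "d1 * d2 * d3 = 1" using d[of 1 1 1 0 0 0] by (simp add: jdet_hmat)
  show "cnj d1 * d1 = 1" using h[of 1 0 0 0 0 0 1 0 0 0 0 0] by (simp add: jherm_hmat)
  show "cnj d2 * d2 = 1" using h[of 0 1 0 0 0 0 0 1 0 0 0 0] by (simp add: jherm_hmat)
  show "cnj d3 * d3 = 1" using h[of 0 0 1 0 0 0 0 0 1 0 0 0] by (simp add: jherm_hmat)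
  show "odot (ccnj (M1 *v x)) (M1 *v y) = odot (ccnj x) y"
    using h[of 0 0 0 x 0 0 0 0 0 y 0 0] by (simp add: jherm_hmat)
  show "odot (ccnj (M2 *v x)) (M2 *v y) = odot (ccnj x) y"
    using h[of 0 0 0 0 x 0 0 0 0 0 y 0] by (simp add: jherm_hmat)
  show "odot (ccnj (M3 *v x)) (M3 *v y) = odot (ccnj x) y"
    using h[of 0 0 0 0 0 x 0 0 0 0 0 y] by (simp add: jherm_hmat)
  show "oform (M1 *v x) (M2 *v y) (M3 *v z) = oform x y z"
    using d[of 0 0 0 x y z] by (simp add: jdet_hmat)
  \<comment> \<open>The determinant only yields the quadratic forms; polarisation recovers the
    bilinear ones.\<close>
  have polar: "e * odot (M *v x) (M *v y) = odot x y"
    if N: "\<And>x. e * odot (M *v x) (M *v x) = odot x x" for e and M :: "complex^8^8"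
  proof -
    have "2 * odot x y = odot (x + y) (x + y) - odot x x - odot y y" for x y :: "complex oct"
      by (simp add: odot_add odot_commute)
    note p = this
    have "2 * (e * odot (M *v x) (M *v y)) = e * (2 * odot (M *v x) (M *v y))" by simp
    also have "\<dots> = 2 * odot x y"
      unfolding p by (simp add: right_diff_distrib N flip: matrix_vector_right_distrib)
    finally show ?thesis by simp
  qed
  show "d1 * odot (M1 *v x) (M1 *v y) = odot x y"
    by (rule polar) (use d[of 1 0 0 _ 0 0] in \<open>simp add: jdet_hmat\<close>)
  show "d2 * odot (M2 *v x) (M2 *v y) = odot x y"
    by (rule polar) (use d[of 0 1 0 0 _ 0] in \<open>simp add: jdet_hmat\<close>)
  show "d3 * odot (M3 *v x) (M3 *v y) = odot x y"
    by (rule polar) (use d[of 0 0 1 0 0 _] in \<open>simp add: jdet_hmat\<close>)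
qed

lemma matrix_of_linear:
  fixes f :: "complex oct \<Rightarrow> complex oct"
  assumes "\<And>x y. f (x + y) = f x + f y" "\<And>c x. f (c *s x) = c *s f x"
  shows "f x = matrix f *v x"
proof -
  have "Vector_Spaces.linear (*s) (*s) f"
    by (simp add: Vector_Spaces.linear_iff vec.vector_space_axioms assms)
  then show ?thesis by (simp add: matrix_works)
qed

lemma eq_minus_self_complex: "- x = x \<longleftrightarrow> x = 0" for x :: complex
  by (simp add: complex_eq_iff)

lemma eq_minus_self_oct: "- x = x \<longleftrightarrow> x = 0" for x :: "complex oct"
  by (simp add: vec_eq_iff eq_minus_self_complex)

text \<open>The diagonal and the three octonion coordinates have four distinct pairs of signs under
  the two involutions, so a map commuting with both preserves each of them. The determinant then
  forbids mixing among the three diagonal entries.\<close>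

lemma fixed_jblockE:
  assumes F: "\<alpha> \<in> E6_fix jsigma \<inter> E6_fix jsigma'"
  obtains d1 d2 d3 M1 M2 M3 where "\<alpha> = jblock d1 d2 d3 M1 M2 M3"
proof -
  have E: "\<alpha> \<in> carrier E6" using F by (simp add: E6_fix_def)
  have s: "jsigma (\<alpha> (jsigma X)) = \<alpha> X" "jsigma' (\<alpha> (jsigma' X)) = \<alpha> X" if "X \<in> JC" for X
    using F that by (auto simp: E6_fix_iff[OF jsigma_in_E6(1) E] E6_fix_iff[OF jsigma_in_E6(2) E])
  note add = E6_memD(3)[OF E] and scale = E6_memD(4)[OF E]
  have ex: "\<exists>p q r u v w. \<alpha> (hmat a b c x y z) = hmat p q r u v w" for a b c x y z
    using JC_cases[OF E6_memD(2)[OF E hmat_in_JC]] by metis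
  \<comment> \<open>An involution negates some coordinates of the argument; this moves the sign
    outside the map.\<close>
  have neg: "\<alpha> (hmat (- a) (- b) (- c) (- x) (- y) (- z)) = cscale (- 1) (\<alpha> (hmat a b c x y z))" for a b c x y z
  proof -
    have "(-1) *s x = - x" for x :: "complex oct" by (simp add: vec_eq_iff)
    then show ?thesis using scale[OF hmat_in_JC, of "- 1" a b c x y z] by (simp add: cscale_hmat)
  qed
  have m1: "(-1) *s x = - x" for x :: "complex oct" by (simp add: vec_eq_iff)
  note eqs = jsigma_hmat hmat_eq_iff cscale_hmat m1 eq_minus_self_oct eq_minus_self_complex
  have diag: "\<exists>p q r. \<alpha> (hmat a b c 0 0 0) = hmat p q r 0 0 0" for a b c
  proof -
    obtain p q r u v w where e: "\<alpha> (hmat a b c 0 0 0) = hmat p q r u v w" using ex by metis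
    show ?thesis
      using s[OF hmat_in_JC, of a b c 0 0 0] by (simp add: e eqs)
  qed
  have off1: "\<exists>u. \<alpha> (hmat 0 0 0 x 0 0) = hmat 0 0 0 u 0 0" for x
  proof -
    obtain p q r u v w where e: "\<alpha> (hmat 0 0 0 x 0 0) = hmat p q r u v w" using ex by metis
    have e': "\<alpha> (hmat 0 0 0 (- x) 0 0) = cscale (- 1) (hmat p q r u v w)"
      using neg[of 0 0 0 x 0 0] by (simp add: e)
    show ?thesis
      using s[OF hmat_in_JC, of 0 0 0 x 0 0] by (simp add: e e' eqs)
  qed
  have off2: "\<exists>u. \<alpha> (hmat 0 0 0 0 x 0) = hmat 0 0 0 0 u 0" for x
  proof -
    obtain p q r u v w where e: "\<alpha> (hmat 0 0 0 0 x 0) = hmat p q r u v w" using ex by metis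
    have e': "\<alpha> (hmat 0 0 0 0 (- x) 0) = cscale (- 1) (hmat p q r u v w)"
      using neg[of 0 0 0 0 x 0] by (simp add: e)
    show ?thesis
      using s[OF hmat_in_JC, of 0 0 0 0 x 0] by (simp add: e e' eqs)
  qed
  have off3: "\<exists>u. \<alpha> (hmat 0 0 0 0 0 x) = hmat 0 0 0 0 0 u" for x
  proof -
    obtain p q r u v w where e: "\<alpha> (hmat 0 0 0 0 0 x) = hmat p q r u v w" using ex by metis
    have e': "\<alpha> (hmat 0 0 0 0 0 (- x)) = cscale (- 1) (hmat p q r u v w)"
      using neg[of 0 0 0 0 0 x] by (simp add: e)
    show ?thesis
      using s[OF hmat_in_JC, of 0 0 0 0 0 x] by (simp add: e e' eqs)
  qed
  obtain p1 q1 r1 where E1: "\<alpha> (hmat 1 0 0 0 0 0) = hmat p1 q1 r1 0 0 0" using diag by metis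
  obtain p2 q2 r2 where E2: "\<alpha> (hmat 0 1 0 0 0 0) = hmat p2 q2 r2 0 0 0" using diag by metis
  obtain p3 q3 r3 where E3: "\<alpha> (hmat 0 0 1 0 0 0) = hmat p3 q3 r3 0 0 0" using diag by metis
  obtain f1 where f1: "\<And>x. \<alpha> (hmat 0 0 0 x 0 0) = hmat 0 0 0 (f1 x) 0 0" using off1 by metis
  obtain f2 where f2: "\<And>x. \<alpha> (hmat 0 0 0 0 x 0) = hmat 0 0 0 0 (f2 x) 0" using off2 by metis
  obtain f3 where f3: "\<And>x. \<alpha> (hmat 0 0 0 0 0 x) = hmat 0 0 0 0 0 (f3 x)" using off3 by metis
  have z: "c *s 0 = (0 :: complex oct)" for c by (simp add: vec_eq_iff)
  define M1 M2 M3 where "M1 = matrix f1" and "M2 = matrix f2" and "M3 = matrix f3"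
  have M1: "f1 x = M1 *v x" for x
    unfolding M1_def
  proof (rule matrix_of_linear)
    show "f1 (x + y) = f1 x + f1 y" for x y
      using add[OF hmat_in_JC hmat_in_JC, of 0 0 0 x 0 0 0 0 0 y 0 0] by (simp add: hmat_add f1 hmat_eq_iff)
    show "f1 (c *s x) = c *s f1 x" for c x
      using scale[OF hmat_in_JC, of c 0 0 0 x 0 0] by (simp add: cscale_hmat f1 hmat_eq_iff z)
  qed
  have M2: "f2 x = M2 *v x" for x
    unfolding M2_def
  proof (rule matrix_of_linear)
    show "f2 (x + y) = f2 x + f2 y" for x y
      using add[OF hmat_in_JC hmat_in_JC, of 0 0 0 0 x 0 0 0 0 0 y 0] by (simp add: hmat_add f2 hmat_eq_iff)
    show "f2 (c *s x) = c *s f2 x" for c x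
      using scale[OF hmat_in_JC, of c 0 0 0 0 x 0] by (simp add: cscale_hmat f2 hmat_eq_iff z)
  qed
  have M3: "f3 x = M3 *v x" for x
    unfolding M3_def
  proof (rule matrix_of_linear)
    show "f3 (x + y) = f3 x + f3 y" for x y
      using add[OF hmat_in_JC hmat_in_JC, of 0 0 0 0 0 x 0 0 0 0 0 y] by (simp add: hmat_add f3 hmat_eq_iff)
    show "f3 (c *s x) = c *s f3 x" for c x
      using scale[OF hmat_in_JC, of c 0 0 0 0 0 x] by (simp add: cscale_hmat f3 hmat_eq_iff z)
  qed
  have G: "\<alpha> (hmat a b c x y z) =
      hmat (a * p1 + b * p2 + c * p3) (a * q1 + b * q2 + c * q3) (a * r1 + b * r2 + c * r3)
        (M1 *v x) (M2 *v y) (M3 *v z)" for a b c x y z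
  proof -
    let ?S = "cscale a (hmat 1 0 0 0 0 0) + (cscale b (hmat 0 1 0 0 0 0) +
        (cscale c (hmat 0 0 1 0 0 0) + (hmat 0 0 0 x 0 0 + (hmat 0 0 0 0 y 0 + hmat 0 0 0 0 0 z))))"
    have S: "?S = hmat a b c x y z"
      by (simp add: cscale_hmat hmat_add z)
    have "\<alpha> ?S = cscale a (hmat p1 q1 r1 0 0 0) + (cscale b (hmat p2 q2 r2 0 0 0) +
        (cscale c (hmat p3 q3 r3 0 0 0) + (hmat 0 0 0 (f1 x) 0 0 + (hmat 0 0 0 0 (f2 y) 0 + hmat 0 0 0 0 0 (f3 z)))))"
      by (simp only: add scale JC_add JC_cscale hmat_in_JC E1 E2 E3 f1 f2 f3)
    then show ?thesis unfolding S by (simp add: cscale_hmat hmat_add z M1 M2 M3 add.assoc)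
  qed
  have det: "jdet (hmat (a * p1 + b * p2 + c * p3) (a * q1 + b * q2 + c * q3) (a * r1 + b * r2 + c * r3)
        (M1 *v x) (M2 *v y) (M3 *v z)) = jdet (hmat a b c x y z)" for a b c x y z
    using E6_memD(5)[OF E hmat_in_JC, of a b c x y z] by (simp only: G)
  have oo: "odot oone oone = (1::complex)" by (simp add: odot_def sum_8 oone_def axis_def)
  have pr: "p1 * q1 * r1 = 0" "p2 * q2 * r2 = 0" "p3 * q3 * r3 = 0"
    using det[of 1 0 0 0 0 0] det[of 0 1 0 0 0 0] det[of 0 0 1 0 0 0] by (simp_all add: jdet_hmat)
  \<comment> \<open>The three equations share one factor. The equation with value 1 shows that it is
    nonzero, so the other two coefficients vanish; the same argument serves for \<open>q\<close> and
    \<open>r\<close>.\<close>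
  have "p1 * odot (M1 *v oone) (M1 *v oone) = 1" "p2 * odot (M1 *v oone) (M1 *v oone) = 0"
    "p3 * odot (M1 *v oone) (M1 *v oone) = 0"
    using det[of 1 0 0 oone 0 0] det[of 0 1 0 oone 0 0] det[of 0 0 1 oone 0 0] pr
    by (simp_all add: jdet_hmat oo)
  then have p: "p2 = 0" "p3 = 0" by auto
  have "q1 * odot (M2 *v oone) (M2 *v oone) = 0" "q2 * odot (M2 *v oone) (M2 *v oone) = 1"
    "q3 * odot (M2 *v oone) (M2 *v oone) = 0"
    using det[of 1 0 0 0 oone 0] det[of 0 1 0 0 oone 0] det[of 0 0 1 0 oone 0] pr
    by (simp_all add: jdet_hmat oo)
  then have q: "q1 = 0" "q3 = 0" by auto
  have "r1 * odot (M3 *v oone) (M3 *v oone) = 0" "r2 * odot (M3 *v oone) (M3 *v oone) = 0"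
    "r3 * odot (M3 *v oone) (M3 *v oone) = 1"
    using det[of 1 0 0 0 0 oone] det[of 0 1 0 0 0 oone] det[of 0 0 1 0 0 oone] pr
    by (simp_all add: jdet_hmat oo)
  then have r: "r1 = 0" "r2 = 0" by auto
  have "\<alpha> = jblock p1 q2 r3 M1 M2 M3"
  proof (rule extensional_JC_eqI)
    show "\<alpha> \<in> extensional JC" using E6_memD(1)[OF E] by (simp add: Bij_def)
  qed (simp_all add: jblock_extensional G p q r jblock_hmat mult.commute)
  then show thesis by (rule that)
qed

text \<open>Nothing is assumed about determinants: a preserved trilinear form makes each component a
  triality map, after a cyclic rotation, and triality maps among orthogonal ones have determinant
  1.\<close>

lemma Spin8I:
  assumes O: "orthogonal_matrix A1" "orthogonal_matrix A2" "orthogonal_matrix A3"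
    and o: "\<And>x y z. oform (A1 *v x) (A2 *v y) (A3 *v z) = oform x y z"
  shows "(A1, A2, A3) \<in> carrier Spin8"
proof -
  have inv: "A *v (transpose A *v x) = x" if "orthogonal_matrix A" for A :: "real^8^8" and x
    using that by (simp add: orthogonal_matrix_def matrix_vector_mul_assoc del: transpose_matrix_vector)
  have tri: "omult (B1 *v x) (B2 *v y) = ocnj (B3 *v ocnj (omult x y))"
    if B3: "orthogonal_matrix B3" and o: "\<And>x y z. oform (B1 *v x) (B2 *v y) (B3 *v z) = oform x y z"
    for B1 B2 B3 :: "real^8^8" and x y
  proof (rule odot_ext)
    fix z
    \<comment> \<open>Orthogonality of \<open>B3\<close> lets an arbitrary \<open>z\<close> be
      written as \<open>ocnj (B3 *v w)\<close>, the form in which the trilinear hypothesis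
      applies.\<close>
    define w where "w = transpose B3 *v ocnj z"
    have z: "z = ocnj (B3 *v w)" by (simp add: w_def inv[OF B3] del: transpose_matrix_vector)
    have "odot (omult (B1 *v x) (B2 *v y)) z = odot (omult x y) (ocnj w)"
      using o[of x y w] by (simp add: z oform_odot)
    also have "\<dots> = odot (ocnj (omult x y)) w" by (metis odot_ocnj ocnj_ocnj)
    also have "\<dots> = odot (B3 *v ocnj (omult x y)) (B3 *v w)"
      by (simp add: odot_inner inner_orthogonal_matrix[OF B3])
    finally show "odot (omult (B1 *v x) (B2 *v y)) z = odot (ocnj (B3 *v ocnj (omult x y))) z"
      by (simp add: z)
  qed
  have bij: "bij ((*v) A)" if "orthogonal_matrix A" for A :: "real^8^8"
  proof (rule o_bij)
    show "(*v) A \<circ> (*v) (transpose A) = id" "(*v) (transpose A) \<circ> (*v) A = id"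
      using that by (simp_all add: fun_eq_iff orthogonal_matrix_def matrix_vector_mul_assoc
          del: transpose_matrix_vector)
  qed
  have bc: "bij (ocnj :: real oct \<Rightarrow> real oct)"
    by (rule o_bij[of ocnj]) (simp_all add: fun_eq_iff)
  have det: "det B1 = 1"
    if "orthogonal_matrix B1" "orthogonal_matrix B2" and B3: "orthogonal_matrix B3"
      and o: "\<And>x y z. oform (B1 *v x) (B2 *v y) (B3 *v z) = oform x y z"
    for B1 B2 B3 :: "real^8^8"
  proof (rule det_triality_map)
    have "bij (ocnj \<circ> ((*v) B3 \<circ> ocnj))" by (intro bij_comp bc bij B3)
    then have "bij (\<lambda>x. ocnj (B3 *v ocnj x))" by (simp add: comp_def)
    then show "(*v) B1 \<in> triality_maps"
      unfolding triality_maps_def using tri[OF B3 o] bij[OF that(2)] by blast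
  qed fact
  have "oform (A2 *v x) (A3 *v y) (A1 *v z) = oform x y z"
    "oform (A3 *v x) (A1 *v y) (A2 *v z) = oform x y z" for x y z
    by (metis o oform_cyclic)+
  then have "det A1 = 1" "det A2 = 1" "det A3 = 1"
    using det[OF O o] det[OF O(2,3,1)] det[OF O(3,1,2)] by blast+
  then show ?thesis using O tri[OF O(3) o] by (simp add: Spin8_iff)
qed

lemma unit_complex_iff: "cnj z * z = 1 \<longleftrightarrow> norm z = 1"
proof -
  have "cnj z * z = complex_of_real ((norm z)^2)" by (simp only: complex_norm_square mult.commute)
  then have "cnj z * z = 1 \<longleftrightarrow> (norm z)^2 = 1" by (simp only: of_real_eq_1_iff)
  moreover have "norm z \<noteq> - 1" by (metis norm_ge_zero not_one_le_zero neg_0_le_iff_le)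
  ultimately show ?thesis by (simp add: power2_eq_1_iff)
qed

text \<open>The scalars on the diagonal determine \<open>t\<close> and \<open>n\<close> up to
  finitely many choices; dividing out the resulting units leaves real matrices, to which
  \<open>Spin8I\<close> applies.\<close>

lemma phi_surj:
  assumes F: "\<alpha> \<in> E6_fix jsigma \<inter> E6_fix jsigma'"
  shows "\<alpha> \<in> phi ` carrier UUSpin"
proof -
  obtain d1 d2 d3 M1 M2 M3 where a: "\<alpha> = jblock d1 d2 d3 M1 M2 M3" by (rule fixed_jblockE[OF F])
  have "jblock d1 d2 d3 M1 M2 M3 \<in> carrier E6" using F by (simp add: a E6_fix_def)
  note J = jblock_E6D[OF this]
  \<comment> \<open>\<open>csqrt\<close> merely picks roots: any solution of \<open>t^4 = d1\<close>
    and \<open>n^2 = t^2 * d2\<close> would do.\<close>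
  define t where "t = csqrt (csqrt d1)"
  define n where "n = csqrt (t^2 * d2)"
  have t4: "t^4 = d1"
  proof -
    have "t^4 = (t^2)^2" by simp
    then show ?thesis by (simp add: t_def)
  qed
  have n2: "n^2 = t^2 * d2" by (simp add: n_def)
  have "norm t ^ 4 = 1" using J(2) by (simp add: unit_complex_iff t4 flip: norm_power)
  then have nt: "norm t = 1" using power_eq_imp_eq_base[of "norm t" 4 1] by simp
  have "norm n ^ 2 = 1"
    using J(3) nt by (simp add: unit_complex_iff n2 norm_mult norm_power flip: norm_power[of n])
  then have nn: "norm n = 1" using power_eq_imp_eq_base[of "norm n" 2 1] by simp
  have t: "cnj t * t = 1" and n: "cnj n * n = 1" using nt nn by (simp_all add: unit_complex_iff)
  have U: "(cnj t)^k * t^k = 1" "(cnj n)^k * n^k = 1" for k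
    using t n by (simp_all flip: power_mult_distrib)
  have e2: "(cnj t)^2 * n^2 = d2" using U(1)[of 2] by (simp add: n2 flip: mult.assoc)
  \<comment> \<open>The third scalar is not chosen freely: it is the inverse of
    \<open>d1 * d2\<close>.\<close>
  have e3: "(cnj t)^2 * (cnj n)^2 = d3"
  proof -
    have "t^2 * n^2 = d1 * d2" unfolding n2 t4[symmetric] by (simp add: power2_eq_square power4_eq_xxxx)
    then have "t^2 * n^2 * d3 = 1" using J(1) by simp
    moreover have "(cnj t)^2 * (cnj n)^2 * (t^2 * n^2) = ((cnj t)^2 * t^2) * ((cnj n)^2 * n^2)" by simp
    then have "(cnj t)^2 * (cnj n)^2 * (t^2 * n^2) = 1" by (simp add: U)
    ultimately show ?thesis by (metis mult.assoc mult_1_left mult_1_right)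
  qed
  \<comment> \<open>The three numbers are unit square roots of \<open>d1\<close>, \<open>d2\<close>,
    \<open>d3\<close> with product 1; their conjugates are the scalars that \<open>phi\<close> puts
    on the matrices.\<close>
  have k: "cnj (t^2) * t^2 = 1" "cnj (cnj t * n) * (cnj t * n) = 1" "cnj (cnj t * cnj n) * (cnj t * cnj n) = 1"
    unfolding unit_complex_iff by (simp_all add: norm_mult norm_power nt nn)
  have k2: "(t^2)^2 = d1" "(cnj t * n)^2 = d2" "(cnj t * cnj n)^2 = d3"
    by (simp_all add: power_mult_distrib t4 e2 e3)
  obtain A1 where A1: "orthogonal_matrix A1" "M1 = cmat (cnj (t^2)) A1"
    by (rule unit_multiple_of_real_matrixE[OF k(1) k2(1) J(5) J(8)])
  obtain A2 where A2: "orthogonal_matrix A2" "M2 = cmat (cnj (cnj t * n)) A2"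
    by (rule unit_multiple_of_real_matrixE[OF k(2) k2(2) J(6) J(9)])
  obtain A3 where A3: "orthogonal_matrix A3" "M3 = cmat (cnj (cnj t * cnj n)) A3"
    by (rule unit_multiple_of_real_matrixE[OF k(3) k2(3) J(7) J(10)])
  have "(A1, A2, A3) \<in> carrier Spin8"
  proof (rule Spin8I[OF A1(1) A2(1) A3(1)])
    fix x y z
    have "(cnj t)^2 * (t * cnj n) * (t * n) = ((cnj t)^2 * t^2) * ((cnj n)^1 * n^1)"
      by (simp add: power2_eq_square)
    then have c: "(cnj t)^2 * (t * cnj n) * (t * n) = 1" by (simp only: U mult_1_left)
    have r: "oform (cvec x) (cvec y) (cvec z) = complex_of_real (oform x y z)" for x y z
      by (simp add: oform_def cvec_simps) (simp add: cvec_def)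
    have "oform (M1 *v cvec x) (M2 *v cvec y) (M3 *v cvec z) =
        ((cnj t)^2 * (t * cnj n) * (t * n)) * oform (cvec (A1 *v x)) (cvec (A2 *v y)) (cvec (A3 *v z))"
      unfolding A1 A2 A3 cmat_apply[of "cnj (t^2)"] cmat_apply[of "cnj (cnj t * n)"]
        cmat_apply[of "cnj (cnj t * cnj n)"] oform_scale cvec_simps by simp
    then have "complex_of_real (oform (A1 *v x) (A2 *v y) (A3 *v z)) = complex_of_real (oform x y z)"
      using J(11)[of "cvec x" "cvec y" "cvec z"] by (simp only: c mult_1_left r)
    then show "oform (A1 *v x) (A2 *v y) (A3 *v z) = oform x y z" by (simp only: of_real_eq_iff)
  qed
  then have "(t, n, A1, A2, A3) \<in> carrier UUSpin" by (simp add: UUSpin_iff t n)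
  moreover have "phi (t, n, A1, A2, A3) = \<alpha>"
    by (simp add: a phi_def jblock_eq_iff t4 e2 e3 A1(2) A2(2) A3(2))
  ultimately show ?thesis by blast
qed

section \<open>The kernel\<close>

text \<open>With all eight elements listed, membership in the kernel becomes a finite check.\<close>

lemma Z2_Z4_eq:
  "Z2 <#>\<^bsub>UUSpin\<^esub> Z4 =
    {(1, 1, mat 1, mat 1, mat 1), (- \<i>, \<i>, - mat 1, - mat 1, mat 1),
     (-1, -1, mat 1, mat 1, mat 1), (\<i>, - \<i>, - mat 1, - mat 1, mat 1),
     (1, -1, mat 1, - mat 1, - mat 1), (- \<i>, - \<i>, - mat 1, mat 1, - mat 1),
     (-1, 1, mat 1, - mat 1, - mat 1), (\<i>, \<i>, - mat 1, mat 1, - mat 1)}"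
  by (simp add: set_mult_def Z2_def Z4_def UUSpin_simps sigma_spin_def sigma'_spin_def insert_commute)

lemma cmat_eq_one:
  "cmat 1 A = mat 1 \<longleftrightarrow> A = mat 1" "cmat (- 1) A = mat 1 \<longleftrightarrow> A = - mat 1"
proof -
  show 1: "cmat 1 A = mat 1 \<longleftrightarrow> A = mat 1" for A
    by (metis cmat_eq_iff cmat_one zero_neq_one)
  have "cmat (- 1) A = cmat 1 (- A)" by (simp add: vec_eq_iff cmat_nth)
  then show "cmat (- 1) A = mat 1 \<longleftrightarrow> A = - mat 1" by (metis 1 minus_minus)
qed

text \<open>A trivial image leaves four values of \<open>t\<close> and two of \<open>n\<close> for
  each; every such pair dictates the signs of the three matrices.\<close>

lemma phi_eq_one_iff:
  assumes "g \<in> carrier UUSpin"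
  shows "phi g = (\<lambda>X\<in>JC. X) \<longleftrightarrow> g \<in> Z2 <#>\<^bsub>UUSpin\<^esub> Z4"
proof -
  obtain t n A1 A2 A3 where g: "g = (t, n, A1, A2, A3)" by (metis prod.exhaust)
  have t: "cnj t * t = 1" using assms by (simp add: g UUSpin_iff)
  have e: "phi g = (\<lambda>X\<in>JC. X) \<longleftrightarrow> t^4 = 1 \<and> (cnj t)^2 * n^2 = 1 \<and> (cnj t)^2 * (cnj n)^2 = 1 \<and>
     cmat ((cnj t)^2) A1 = mat 1 \<and> cmat (t * cnj n) A2 = mat 1 \<and> cmat (t * n) A3 = mat 1"
    by (simp add: g phi_def jblock_eq_iff flip: jblock_one)
  show ?thesis
  proof
    assume "g \<in> Z2 <#>\<^bsub>UUSpin\<^esub> Z4"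
    then show "phi g = (\<lambda>X\<in>JC. X)"
      unfolding e unfolding g Z2_Z4_eq by (auto simp: cmat_eq_one)
  next
    assume "phi g = (\<lambda>X\<in>JC. X)"
    note * = this[unfolded e]
    have "(t - 1) * (t + 1) * ((t - \<i>) * (t + \<i>)) = t^4 - 1"
      by (simp add: algebra_simps power4_eq_xxxx)
    then have tc: "t = 1 \<or> t = - 1 \<or> t = \<i> \<or> t = - \<i>"
      using * by (simp add: add_eq_0_iff2)
    have "(cnj t * t)^2 * n^2 = t^2 * ((cnj t)^2 * n^2)" by (simp add: power_mult_distrib)
    then have "n^2 = t^2" using * t by simp
    then have nc: "n = t \<or> n = - t" by (simp add: power2_eq_iff)
    show "g \<in> Z2 <#>\<^bsub>UUSpin\<^esub> Z4"
      using tc nc * unfolding g Z2_Z4_eq by (elim disjE) (simp_all add: cmat_eq_one)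
  qed
qed

section \<open>Continuity and compactness\<close>

lemma continuous_on_nth_iff:
  fixes f :: "'a::topological_space \<Rightarrow> ('b::topological_space)^'n"
  shows "continuous_on S f \<longleftrightarrow> (\<forall>i. continuous_on S (\<lambda>x. f x $ i))"
proof
  assume "\<forall>i. continuous_on S (\<lambda>x. f x $ i)"
  then have "continuous_on S (\<lambda>x. \<chi> i. f x $ i)" by (intro continuous_on_vec_lambda) blast
  then show "continuous_on S f" by simp
qed (auto intro: continuous_on_component)

lemma continuous_on_matrix_vector:
  fixes A :: "'a::topological_space \<Rightarrow> ('b::real_normed_algebra_1)^'n^'m"
  assumes "continuous_on S A" "continuous_on S x"
  shows "continuous_on S (\<lambda>p. A p *v x p)"
  unfolding matrix_vector_mult_def
  by (intro continuous_on_vec_lambda continuous_intros assms)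

lemma continuous_on_matrix_matrix:
  fixes A :: "'a::topological_space \<Rightarrow> ('b::real_normed_algebra_1)^'n^'m"
  assumes "continuous_on S A" "continuous_on S B"
  shows "continuous_on S (\<lambda>p. A p ** B p)"
  unfolding matrix_matrix_mult_def
  by (intro continuous_on_vec_lambda continuous_intros assms)

lemma continuous_on_transpose:
  assumes "continuous_on S A"
  shows "continuous_on S (\<lambda>p. transpose (A p))"
  unfolding transpose_def by (intro continuous_on_vec_lambda continuous_intros assms)

lemma continuous_on_det:
  fixes A :: "'a::topological_space \<Rightarrow> real^'n^'n"
  assumes "continuous_on S A"
  shows "continuous_on S (\<lambda>p. det (A p))"
  unfolding det_def by (intro continuous_intros assms)

lemma continuous_on_omult:
  fixes f g :: "'a::topological_space \<Rightarrow> ('b::{real_normed_algebra_1,comm_ring_1}) oct"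
  assumes "continuous_on S f" "continuous_on S g"
  shows "continuous_on S (\<lambda>p. omult (f p) (g p))"
  unfolding continuous_on_nth_iff[of S "\<lambda>p. omult (f p) (g p)"] forall_8
  by (simp add: oct_unfold, intro conjI continuous_intros assms)

lemma continuous_on_ocnj:
  fixes f :: "'a::topological_space \<Rightarrow> ('b::{real_normed_algebra_1,comm_ring_1}) oct"
  assumes "continuous_on S f"
  shows "continuous_on S (\<lambda>p. ocnj (f p))"
  unfolding continuous_on_nth_iff[of S "\<lambda>p. ocnj (f p)"] forall_8
  by (simp, intro conjI continuous_intros assms)

text \<open>The determinant and triality conditions cut out a closed subset of a product of three
  copies of the compact orthogonal group.\<close>

lemma compact_Spin8: "compact (carrier Spin8)"
proof -
  let ?O = "{A :: real^8^8. orthogonal_matrix A}"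
  have "norm (A$i) \<le> 1" if "orthogonal_matrix A" for A :: "real^8^8" and i
  proof -
    have "A ** transpose A = mat 1" using that by (simp add: orthogonal_matrix_def)
    then have "(A ** transpose A)$i$i = 1" by (simp add: mat_def)
    then have "A$i \<bullet> A$i = 1"
      by (simp add: matrix_matrix_mult_def transpose_def inner_vec_def)
    then have "norm (A$i) = 1" by (simp add: norm_eq_1)
    then show ?thesis by simp
  qed
  note row = this
 \<comment> \<open>A crude bound: eight rows, each of norm at most 1.\<close>
 have "norm A \<le> 8" if "orthogonal_matrix A" for A :: "real^8^8"
  proof -
    have "norm A \<le> (\<Sum>i\<in>UNIV. norm (A$i))"
      unfolding norm_vec_def[of A] by (rule L2_set_le_sum) simp
    also have "\<dots> \<le> (\<Sum>i\<in>(UNIV::8 set). 1)"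
      by (rule sum_mono) (rule row[OF that])
    finally show ?thesis by simp
  qed
  then have bO: "bounded ?O" by (auto simp: bounded_iff)
  have "closed {A :: real^8^8. transpose A ** A = mat 1}"
    by (intro closed_Collect_eq continuous_on_matrix_matrix continuous_on_transpose continuous_intros)
  then have cO: "compact ?O"
    using bO by (simp add: compact_eq_bounded_closed orthogonal_matrix)
  have S: "carrier Spin8 = (?O \<times> ?O \<times> ?O) \<inter>
     ({p. det (fst p) = 1} \<inter> {p. det (fst (snd p)) = 1} \<inter> {p. det (snd (snd p)) = 1} \<inter>
      (\<Inter>x. \<Inter>y. {p. omult (fst p *v x) (fst (snd p) *v y) = ocnj (snd (snd p) *v ocnj (omult x y))}))"
    by (auto simp: Spin8_iff)
  show ?thesis
    unfolding S
    by (intro compact_Int_closed compact_Times cO closed_Int closed_INT ballI closed_Collect_eq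
        continuous_on_det continuous_on_omult continuous_on_ocnj continuous_on_matrix_vector continuous_intros)
qed

lemma compact_UUSpin: "compact (carrier UUSpin)"
proof -
  have "carrier UUSpin = sphere 0 1 \<times> sphere 0 1 \<times> carrier Spin8"
    by (auto simp: UUSpin_iff unit_complex_iff)
  then show ?thesis by (simp add: compact_Times compact_Spin8)
qed

lemma continuous_on_hmat:
  fixes f g h :: "'a::topological_space \<Rightarrow> complex"
  assumes "continuous_on S f" "continuous_on S g" "continuous_on S h"
    "continuous_on S x" "continuous_on S y" "continuous_on S z"
  shows "continuous_on S (\<lambda>p. hmat (f p) (g p) (h p) (x p) (y p) (z p))"
proof -
  have s: "continuous_on S (\<lambda>p. f p *s oone)" if "continuous_on S f" for f :: "'a \<Rightarrow> complex"
    unfolding vector_scalar_mult_def by (intro continuous_on_vec_lambda continuous_intros that)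
  have "continuous_on S (\<lambda>p. hmat (f p) (g p) (h p) (x p) (y p) (z p) $ i $ j)" for i j
    using exhaust_3[of i] exhaust_3[of j] assms
    by (elim disjE) (simp_all add: s continuous_on_ocnj)
  then show ?thesis
    by (simp add: continuous_on_nth_iff[where 'n=3])
qed

text \<open>Functions carry the product topology, so continuity is checked at each fixed
  \<open>X\<close>; outside \<open>JC\<close> the value is the constant
  \<open>undefined\<close>.\<close>

lemma continuous_on_phi: "continuous_on S phi"
proof (rule continuous_on_coordinatewise_then_product)
  fix X :: "complex omat"
  have c: "continuous_on S (\<lambda>p. cmat (f p) (A p) *v x)"
    if "continuous_on S f" "continuous_on S A"
    for f :: "complex \<times> complex \<times> (real^8^8) \<times> (real^8^8) \<times> (real^8^8) \<Rightarrow> complex" and A x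
    unfolding cmat_def
    by (intro continuous_on_matrix_vector continuous_on_vec_lambda continuous_intros that)
  show "continuous_on S (\<lambda>p. phi p X)"
  proof (cases "X \<in> JC")
    case True
    then obtain a b c x y z where X: "X = hmat a b c x y z" by (rule JC_cases)
    show ?thesis
      unfolding X phi_def split_beta jblock_hmat
      by (intro continuous_on_hmat c continuous_intros)
  next
    case False
    then have "phi p X = undefined" for p
      by (cases p) (simp add: phi_def jblock_def)
    then show ?thesis by simp
  qed
qed

section \<open>The isomorphism of topological groups\<close>

theorem theorem4p11p6:
  shows "top_group_iso
    (UUSpin Mod (Z2 <#>\<^bsub>UUSpin\<^esub> Z4))
    (coset_topology UUSpin (top_of_set (carrier UUSpin)) (Z2 <#>\<^bsub>UUSpin\<^esub> Z4))
    (E6 \<lparr> carrier := E6_fix jsigma \<inter> E6_fix jsigma' \<rparr>)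
    (top_of_set (E6_fix jsigma \<inter> E6_fix jsigma'))"
proof -
  let ?F = "E6_fix jsigma \<inter> E6_fix jsigma'" and ?N = "Z2 <#>\<^bsub>UUSpin\<^esub> Z4"
  let ?H = "E6 \<lparr> carrier := ?F \<rparr>" and ?T = "top_of_set (carrier UUSpin)"
  \<comment> \<open>A coset has a singleton image under \<open>phi\<close>, and
    \<open>the_elem\<close> extracts its member.\<close>
  let ?Q = "coset_topology UUSpin ?T ?N" and ?f = "\<lambda>C. the_elem (phi ` C)"
  interpret G: group UUSpin by (rule group_UUSpin)
  have mult: "phi (g \<otimes>\<^bsub>UUSpin\<^esub> h) = phi g \<otimes>\<^bsub>E6\<^esub> phi h"
    if "g \<in> carrier UUSpin" "h \<in> carrier UUSpin" for g h
    using that by (simp add: phi_mult E6_mult phi_in_E6)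
  have im: "phi ` carrier UUSpin = ?F" using phi_fixed phi_surj by blast
  have "group_hom UUSpin E6 phi"
    by (simp add: group_hom_def group_hom_axioms_def group_UUSpin group_E6 hom_def phi_in_E6 mult)
  \<comment> \<open>The fixed elements form a group because they are the image of
    \<open>phi\<close>.\<close>
  then have "subgroup ?F E6" using group_hom.img_is_subgroup im by metis
  then have "group ?H" by (rule subgroup.subgroup_is_group[OF _ group_E6])
  then interpret P: group_hom UUSpin ?H phi
    using phi_fixed by (simp add: group_hom_def group_hom_axioms_def group_UUSpin hom_def mult)
  have one: "\<one>\<^bsub>?H\<^esub> = (\<lambda>X\<in>JC. X)" by (simp add: E6_def BijGroup_def)
  have "?N \<subseteq> carrier UUSpin"
    using Z2_Z4_normal normal_imp_subgroup subgroup.subset by blast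
  then have ker: "kernel UUSpin ?H phi = ?N"
    unfolding kernel_def one using phi_eq_one_iff by blast
  have iso: "?f \<in> iso (UUSpin Mod ?N) ?H"
    using P.FactGroup_iso_set im by (simp add: ker)
  have coset: "?f (?N #>\<^bsub>UUSpin\<^esub> g) = phi g" if g: "g \<in> carrier UUSpin" for g
  proof -
    have "phi ` (?N #>\<^bsub>UUSpin\<^esub> g) = {phi g}"
    proof (intro equalityI subsetI)
      fix w assume "w \<in> phi ` (?N #>\<^bsub>UUSpin\<^esub> g)"
      then obtain n where n: "n \<in> ?N" "w = phi (n \<otimes>\<^bsub>UUSpin\<^esub> g)" by (auto simp: r_coset_def)
      then have "n \<in> carrier UUSpin" "phi n = \<one>\<^bsub>?H\<^esub>" by (auto simp: kernel_def simp flip: ker)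
      with n g P.hom_closed[OF g] show "w \<in> {phi g}"
        using P.hom_mult P.H.l_one by (metis singletonI)
    next
      fix w assume "w \<in> {phi g}"
      moreover have "\<one>\<^bsub>UUSpin\<^esub> \<in> ?N"
        using Z2_Z4_normal normal_imp_subgroup subgroup.one_closed by blast
      then have "\<one>\<^bsub>UUSpin\<^esub> \<otimes>\<^bsub>UUSpin\<^esub> g \<in> ?N #>\<^bsub>UUSpin\<^esub> g"
        unfolding r_coset_def by blast
      ultimately show "w \<in> phi ` (?N #>\<^bsub>UUSpin\<^esub> g)"
        unfolding G.l_one[OF g] by blast
    qed
    then show ?thesis by simp
  qed
  have cosets: "carrier (UUSpin Mod ?N) = (\<lambda>g. ?N #>\<^bsub>UUSpin\<^esub> g) ` carrier UUSpin"
    by (auto simp: FactGroup_def RCOSETS_def)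
  \<comment> \<open>The quotient topology is given by its open sets, so its underlying space must be
    identified: the set of all cosets is itself open.\<close>
  have "openin ?Q (carrier (UUSpin Mod ?N))"
  proof -
    have "{g \<in> topspace ?T. ?N #>\<^bsub>UUSpin\<^esub> g \<in> carrier (UUSpin Mod ?N)} = topspace ?T"
      by (auto simp: cosets)
    then show ?thesis by (simp add: openin_coset_topology)
  qed
  then have top: "topspace ?Q = carrier (UUSpin Mod ?N)"
    using iffD1[OF openin_coset_topology openin_topspace] openin_subset by (intro subset_antisym) blast+
  have "continuous_map ?T ?Q (\<lambda>g. ?N #>\<^bsub>UUSpin\<^esub> g)"
    unfolding continuous_map_def top by (auto simp: cosets openin_coset_topology)
  then have "compactin ?Q ((\<lambda>g. ?N #>\<^bsub>UUSpin\<^esub> g) ` carrier UUSpin)"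
    by (rule image_compactin[rotated]) (simp add: compactin_subtopology compact_UUSpin)
  then have comp: "compact_space ?Q" by (simp add: compact_space_def top cosets)
  \<comment> \<open>The topology of pointwise convergence is a product of Hausdorff spaces.\<close>
  have haus: "Hausdorff_space (top_of_set ?F)"
    unfolding euclidean_product_topology[symmetric]
    by (intro Hausdorff_space_subtopology) (simp add: Hausdorff_space_product_topology)
  have phi_cont: "continuous_map ?T (top_of_set ?F) phi"
    using continuous_on_phi phi_fixed by (auto simp: continuous_map_in_subtopology)
  have f_cont: "continuous_map ?Q (top_of_set ?F) ?f"
    unfolding continuous_map_def
  proof (intro conjI allI impI)
    show "?f \<in> topspace ?Q \<rightarrow> topspace (top_of_set ?F)"
      using coset phi_fixed by (auto simp: top cosets)
    fix U assume U: "openin (top_of_set ?F) U"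
    \<comment> \<open>Pulling a preimage under \<open>?f\<close> back along the coset projection
      gives the preimage under \<open>phi\<close>.\<close>
    have "{g \<in> topspace ?T. ?N #>\<^bsub>UUSpin\<^esub> g \<in> {C \<in> topspace ?Q. ?f C \<in> U}} =
        {g \<in> topspace ?T. phi g \<in> U}"
      using coset by (auto simp: top cosets)
    then show "openin ?Q {C \<in> topspace ?Q. ?f C \<in> U}"
      using openin_continuous_map_preimage[OF phi_cont U] by (auto simp: openin_coset_topology top)
  qed
  have "homeomorphic_map ?Q (top_of_set ?F) ?f"
  proof (rule continuous_imp_homeomorphic_map[OF f_cont comp haus])
    show "?f ` topspace ?Q = topspace (top_of_set ?F)" "inj_on ?f (topspace ?Q)"
      using iso by (auto simp: top iso_def bij_betw_def)
  qed
  with iso show ?thesis unfolding top_group_iso_def by blast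
qed

end
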